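(* Let $n\ge1$, $s=(s_1,\dots,s_n)$ with $s_\nu\in\mathbb{N}_0$, with admissible coefficients (as defined in the context) of level $s_\nu$ fixed for each $\nu$, and let $e\subset\{1,\dots,n\}$, $e\ne\emptyset$, $j\in\mathbb{Z}$, $a\in I_2^n$. Then the function $$\Psi^{(s)}_{e;ja}(x)=2^{-nj/2}\sum_{r_1=0}^{2^{s_1}-1}\cdots\sum_{r_n=0}^{2^{s_n}-1}\alpha^{(k_e)_1}_{1,r_1}\cdots\alpha^{(k_e)_n}_{n,r_n}\,\Psi^{(0)}_e\Big(2^jx-a-\Big(\frac{r_1}{2^{s_1}}(k_e)_1,\dots,\frac{r_n}{2^{s_n}}(k_e)_n\Big)\Big)$$ is an eigenfunction of the Taibleson fractional operator $D^\alpha$ with eigenvalue $2^{\alpha(1-j)}$, i.e. $$D^\alpha\Psi^{(s)}_{e;ja}=2^{\alpha(1-j)}\Psi^{(s)}_{e;ja},\qquad\alpha\in\mathbb{C}.$$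
   Context: $\mathbb{Q}_2$ is the field of $2$-adic numbers; on $\mathbb{Q}_2^n$ use the norm $|x|_2=\max_\nu|x_\nu|_2$ and the product Haar measure $d^nx$ normalized so that $\mathbb{Z}_2^n$ has measure $1$. $\chi_2(t)=e^{2\pi i\{t\}_2}$, $t\in\mathbb{Q}_2$, with $\{t\}_2$ the $2$-adic fractional part; $\xi\cdot x=\sum_\nu\xi_\nu x_\nu$. $\Omega(t)=1$ for $0\le t\le1$, $\Omega(t)=0$ for $t>1$. $I_2=\{2^{-\gamma}(a_0+a_12+\cdots+a_{\gamma-1}2^{\gamma-1}):\gamma\in\mathbb{N},\ a_j\in\{0,1\}\}\subset\mathbb{Q}_2$, $I_2^n=I_2\times\cdots\times I_2$, $\mathbb{N}_0=\{0,1,2,\dots\}$. For $e\subset\{1,\dots,n\}$, $k_e\in\{0,1\}^n$ has $(k_e)_\nu=1$ if $\nu\in e$ and $0$ otherwise, and $\Psi^{(0)}_e(x)=\chi_2(2^{-1}k_e\cdot x)\,\Omega(|x|_2)$. Admissible coefficients of level $s_\nu$: if $s_\nu\ge1$, choose $\gamma_{\nu,0},\dots,\gamma_{\nu,2^{s_\nu}-1}\in\mathbb{C}$ of modulus $1$ and put $$\alpha^1_{\nu,k}=2^{-s_\nu}(-1)^k\sum_{r=0}^{2^{s_\nu}-1}\gamma_{\nu,r}\,e^{-i\pi\frac{2r+1}{2^{s_\nu}}k},\quad k=0,\dots,2^{s_\nu}-1;$$ if $s_\nu=0$, put $\alpha^1_{\nu,0}=1$. In all cases put $\alpha^0_{\nu,0}=1$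 and $\alpha^0_{\nu,k}=0$ for $k=1,\dots,2^{s_\nu}-1$. (The superscripts $0,1$ are indices, not powers; these coefficients are unrelated to the exponent $\alpha$ of $D^\alpha$.) Fourier transform on locally constant compactly supported functions: $F[\varphi](\xi)=\int_{\mathbb{Q}_2^n}\chi_2(\xi\cdot x)\varphi(x)\,d^nx$, with inverse $F^{-1}[\varphi](x)=\int_{\mathbb{Q}_2^n}\chi_2(-x\cdot\xi)\varphi(\xi)\,d^n\xi$. The Lizorkin space $\Phi(\mathbb{Q}_2^n)$ consists of the locally constant compactly supported $\phi:\mathbb{Q}_2^n\to\mathbb{C}$ with $\int\phi\,d^nx=0$ (equivalently $F[\phi](0)=0$); each $\Psi^{(s)}_{e;ja}$ belongs to it. For $\alpha\in\mathbb{C}$, the Taibleson fractional operator on $\Phi(\mathbb{Q}_2^n)$ is the pseudo-differential operator with symbol $|\xi|_2^\alpha$: $D^\alpha\phi=F^{-1}\big[|\cdot|_2^\alpha F[\phi]\big]$ (here $F[\phi]$ vanishes near $0$ and the product is taken to be $0$ at $0$); equivalently, it is convolution with the Riesz kernel $\kappa_{-\alpha}$. *)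

theory Defs
  imports "HOL-Analysis.Analysis"
begin

definition rat_abs2 :: "rat \<Rightarrow> real" where
  "rat_abs2 q = (if q = 0 then 0 else
     2 powi (int (multiplicity 2 (snd (quotient_of q))) - int (multiplicity 2 (fst (quotient_of q)))))"

lemma rat_abs2_divide:
  assumes "a \<noteq> 0" "b \<noteq> 0"
  shows "rat_abs2 (of_int a / of_int b) = 2 powi (int (multiplicity 2 b) - int (multiplicity 2 a))"
proof -
  define q :: rat where "q = of_int a / of_int b"
  obtain p r where pr: "quotient_of q = (p, r)" by fastforce
  have r: "r > 0" using pr quotient_of_denom_pos by blast
  have q: "q = of_int p / of_int r" using pr quotient_of_div by blast
  have q0: "q \<noteq> 0" using assms by (simp add: q_def)
  then have p0: "p \<noteq> 0" using q by auto
  have "(of_int (p * b) :: rat) = of_int (a * r)"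
    using q q_def assms r by (simp add: field_simps)
  then have e: "p * b = a * r" by (simp only: of_int_eq_iff)
  have "multiplicity 2 p + multiplicity 2 b = multiplicity 2 a + multiplicity 2 r"
  proof -
    have pe: "prime_elem (2::int)" by simp
    have "multiplicity 2 (p * b) = multiplicity 2 p + multiplicity 2 b"
      using prime_elem_multiplicity_mult_distrib[OF pe p0 assms(2)] .
    moreover have "multiplicity 2 (a * r) = multiplicity 2 a + multiplicity 2 r"
      using prime_elem_multiplicity_mult_distrib[OF pe assms(1)] r by auto
    ultimately show ?thesis using e by simp
  qed
  then have "int (multiplicity 2 r) - int (multiplicity 2 p)
           = int (multiplicity 2 b) - int (multiplicity 2 a)" by linarith
  then show ?thesis using q0 pr by (simp add: rat_abs2_def flip: q_def)
qed

lemma rat_abs2_0 [simp]: "rat_abs2 0 = 0"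
  by (simp add: rat_abs2_def)

lemma rat_abs2_eq_0 [simp]: "rat_abs2 q = 0 \<longleftrightarrow> q = 0"
  by (simp add: rat_abs2_def)

lemma rat_abs2_nonneg [simp]: "rat_abs2 q \<ge> 0"
  by (simp add: rat_abs2_def)

lemma rat_quotientE:
  obtains a b :: int where "(q::rat) = of_int a / of_int b" "b \<noteq> 0"
  by (metis Fract_of_int_quotient Rat_cases less_irrefl)

lemma rat_abs2_mult [simp]: "rat_abs2 (x * y) = rat_abs2 x * rat_abs2 y"
proof (cases "x = 0 \<or> y = 0")
  case False
  obtain a b where x: "x = of_int a / of_int b" "b \<noteq> 0" by (rule rat_quotientE)
  obtain c d where y: "y = of_int c / of_int d" "d \<noteq> 0" by (rule rat_quotientE)
  have nz: "a \<noteq> 0" "c \<noteq> 0" using False x y by auto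
  have xy: "x * y = of_int (a * c) / of_int (b * d)" using x y by simp
  have pe: "prime_elem (2::int)" by simp
  show ?thesis
    unfolding xy x(1) y(1)
    using nz x(2) y(2)
    by (simp add: rat_abs2_divide prime_elem_multiplicity_mult_distrib[OF pe] algebra_simps
        flip: power_int_add of_int_mult)
qed auto

lemma rat_abs2_1 [simp]: "rat_abs2 1 = 1"
  using rat_abs2_divide[of 1 1] by simp

lemma rat_abs2_minus [simp]: "rat_abs2 (- x) = rat_abs2 x"
proof -
  have "multiplicity (2::int) (-1) = 0" by (rule not_dvd_imp_multiplicity_0) simp
  then have "rat_abs2 (-1) = 1"
    using rat_abs2_divide[of "-1" 1] by simp
  then show ?thesis using rat_abs2_mult[of "-1" x] by simp
qed

lemma rat_abs2_minus_commute: "rat_abs2 (x - y) = rat_abs2 (y - x)"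
  using rat_abs2_minus[of "x - y"] by simp

lemma rat_abs2_inverse [simp]: "rat_abs2 (inverse x) = inverse (rat_abs2 x)"
proof (cases "x = 0")
  case False
  then have "rat_abs2 x * rat_abs2 (inverse x) = 1"
    by (simp flip: rat_abs2_mult)
  then show ?thesis by (metis inverse_unique)
qed simp

lemma rat_abs2_add_le_max: "rat_abs2 (x + y) \<le> max (rat_abs2 x) (rat_abs2 y)"
proof (cases "x = 0 \<or> y = 0 \<or> x + y = 0")
  case True
  then show ?thesis by (auto simp: max_def)
next
  case False
  obtain a b where x: "x = of_int a / of_int b" "b \<noteq> 0" by (rule rat_quotientE)
  obtain c d where y: "y = of_int c / of_int d" "d \<noteq> 0" by (rule rat_quotientE)
  define A B D where "A = a * d" and "B = c * b" and "D = b * d"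
  have D: "D \<noteq> 0" using x y by (simp add: D_def)
  have x': "x = of_int A / of_int D" using x y by (simp add: A_def D_def)
  have y': "y = of_int B / of_int D" using x y by (simp add: B_def D_def)
  have s: "x + y = of_int (A + B) / of_int D" using x' y' by (simp add: add_divide_distrib)
  have nz: "A \<noteq> 0" "B \<noteq> 0" "A + B \<noteq> 0" using False x' y' s by auto
  define m where "m = min (multiplicity 2 A) (multiplicity 2 B)"
  have "2 ^ m dvd A" "2 ^ m dvd B"
    by (auto simp: m_def intro!: multiplicity_dvd')
  then have "2 ^ m dvd A + B" by simp
  then have "m \<le> multiplicity 2 (A + B)"
    using nz by (intro multiplicity_geI) auto
  then have le: "2 powi (int (multiplicity 2 D) - int (multiplicity 2 (A + B)))
           \<le> (2::real) powi (int (multiplicity 2 D) - int m)"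
    by (intro power_int_increasing) auto
  have "(2::real) powi (int (multiplicity 2 D) - int m) \<le> max (rat_abs2 x) (rat_abs2 y)"
    unfolding x' y' using nz D
    by (cases "multiplicity 2 A \<le> multiplicity 2 B") (auto simp: m_def rat_abs2_divide min_def)
  then show ?thesis unfolding s using le nz D by (simp add: rat_abs2_divide del: of_int_add)
qed

lemma rat_abs2_add_le: "rat_abs2 (x + y) \<le> rat_abs2 x + rat_abs2 y"
  using rat_abs2_add_le_max[of x y] rat_abs2_nonneg[of x] rat_abs2_nonneg[of y] by linarith

lemma rat_abs2_diff_le: "\<bar>rat_abs2 x - rat_abs2 y\<bar> \<le> rat_abs2 (x - y)"
  using rat_abs2_add_le[of "x - y" y] rat_abs2_add_le[of "y - x" x] rat_abs2_minus_commute[of x y]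
  by simp

text \<open>The 2-adic numbers \<open>q2\<close> are Cauchy sequences of rationals modulo null sequences,
  with respect to the 2-adic absolute value.\<close>

definition cauchy2 :: "(nat \<Rightarrow> rat) \<Rightarrow> bool" where
  "cauchy2 X \<longleftrightarrow> (\<forall>e>0. \<exists>N. \<forall>m\<ge>N. \<forall>n\<ge>N. rat_abs2 (X m - X n) < e)"

definition null2 :: "(nat \<Rightarrow> rat) \<Rightarrow> bool" where
  "null2 X \<longleftrightarrow> (\<lambda>n. rat_abs2 (X n)) \<longlonglongrightarrow> 0"

definition q2_rel :: "(nat \<Rightarrow> rat) \<Rightarrow> (nat \<Rightarrow> rat) \<Rightarrow> bool" where
  "q2_rel X Y \<longleftrightarrow> cauchy2 X \<and> cauchy2 Y \<and> null2 (\<lambda>n. X n - Y n)"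

lemma cauchy2_const [simp]: "cauchy2 (\<lambda>_. c)"
  by (auto simp: cauchy2_def)

lemma null2_0 [simp]: "null2 (\<lambda>_. 0)"
  by (simp add: null2_def)

lemma null2_const_iff [simp]: "null2 (\<lambda>_. c) \<longleftrightarrow> c = 0"
  by (simp add: null2_def LIMSEQ_const_iff)

lemma null2_minus [simp]: "null2 (\<lambda>n. - X n) \<longleftrightarrow> null2 X"
  by (simp add: null2_def)

lemma squeeze_0:
  fixes f g :: "nat \<Rightarrow> real"
  shows "g \<longlonglongrightarrow> 0 \<Longrightarrow> (\<And>n. 0 \<le> f n) \<Longrightarrow> (\<And>n. f n \<le> g n) \<Longrightarrow> f \<longlonglongrightarrow> 0"
  by (rule real_tendsto_sandwich[of "\<lambda>_. 0" f sequentially g]) auto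

lemma null2_add:
  assumes "null2 X" "null2 Y"
  shows "null2 (\<lambda>n. X n + Y n)"
proof -
  have "(\<lambda>n. rat_abs2 (X n) + rat_abs2 (Y n)) \<longlonglongrightarrow> 0"
    using assms tendsto_add[of "\<lambda>n. rat_abs2 (X n)" 0 sequentially "\<lambda>n. rat_abs2 (Y n)" 0]
    by (simp add: null2_def)
  then show ?thesis unfolding null2_def
    by (rule squeeze_0) (auto simp: rat_abs2_add_le)
qed

lemma null2_diff: "null2 X \<Longrightarrow> null2 Y \<Longrightarrow> null2 (\<lambda>n. X n - Y n)"
  using null2_add[of X "\<lambda>n. - Y n"] by simp

lemma cauchy2_abs: "cauchy2 X \<Longrightarrow> Cauchy (\<lambda>n. rat_abs2 (X n))"
  unfolding cauchy2_def Cauchy_def dist_real_def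
  by (meson rat_abs2_diff_le order_le_less_trans)

lemma cauchy2_abs_tendsto:
  "cauchy2 X \<Longrightarrow> (\<lambda>n. rat_abs2 (X n)) \<longlonglongrightarrow> lim (\<lambda>n. rat_abs2 (X n))"
  using cauchy2_abs Cauchy_convergent convergent_LIMSEQ_iff by blast

lemma cauchy2_bounded:
  assumes "cauchy2 X"
  obtains B where "B > 0" "\<And>n. rat_abs2 (X n) \<le> B"
  using cauchy2_abs[OF assms] Cauchy_Bseq[of "\<lambda>n. rat_abs2 (X n)"]
  by (auto elim!: BseqE)

lemma null2_mult:
  assumes "cauchy2 X" "null2 Y"
  shows "null2 (\<lambda>n. X n * Y n)"
proof -
  obtain B where B: "B > 0" "\<And>n. rat_abs2 (X n) \<le> B" using cauchy2_bounded[OF assms(1)] by blast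
  have "(\<lambda>n. B * rat_abs2 (Y n)) \<longlonglongrightarrow> 0"
    using assms(2) by (auto simp: null2_def intro: tendsto_mult_right_zero)
  then show ?thesis unfolding null2_def
    by (rule squeeze_0) (auto simp: B mult_right_mono)
qed

lemma cauchy2_minus: "cauchy2 X \<Longrightarrow> cauchy2 (\<lambda>n. - X n)"
proof -
  have "rat_abs2 (- x - - y) = rat_abs2 (x - y)" for x y
    using rat_abs2_minus_commute[of x y] by simp
  then show "cauchy2 X \<Longrightarrow> cauchy2 (\<lambda>n. - X n)" unfolding cauchy2_def by metis
qed

lemma cauchy2_add:
  assumes "cauchy2 X" "cauchy2 Y"
  shows "cauchy2 (\<lambda>n. X n + Y n)"
  unfolding cauchy2_def
proof (intro allI impI)
  fix e :: real assume "e > 0"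
  then obtain N M where
    N: "\<And>m n. m \<ge> N \<Longrightarrow> n \<ge> N \<Longrightarrow> rat_abs2 (X m - X n) < e" and
    M: "\<And>m n. m \<ge> M \<Longrightarrow> n \<ge> M \<Longrightarrow> rat_abs2 (Y m - Y n) < e"
    using assms unfolding cauchy2_def by meson
  have "rat_abs2 ((X m + Y m) - (X n + Y n)) < e" if "m \<ge> max N M" "n \<ge> max N M" for m n
  proof -
    have "rat_abs2 ((X m - X n) + (Y m - Y n)) < e"
      using rat_abs2_add_le_max[of "X m - X n" "Y m - Y n"] N[of m n] M[of m n] that by auto
    then show ?thesis by (simp add: algebra_simps)
  qed
  then show "\<exists>N. \<forall>m\<ge>N. \<forall>n\<ge>N. rat_abs2 ((X m + Y m) - (X n + Y n)) < e" by blast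
qed

lemma cauchy2_diff: "cauchy2 X \<Longrightarrow> cauchy2 Y \<Longrightarrow> cauchy2 (\<lambda>n. X n - Y n)"
  using cauchy2_add[of X "\<lambda>n. - Y n"] cauchy2_minus[of Y] by simp

lemma cauchy2_mult:
  assumes X: "cauchy2 X" and Y: "cauchy2 Y"
  shows "cauchy2 (\<lambda>n. X n * Y n)"
  unfolding cauchy2_def
proof (intro allI impI)
  fix e :: real assume e: "e > 0"
  obtain A where A: "A > 0" "\<And>n. rat_abs2 (X n) \<le> A" using cauchy2_bounded[OF X] by blast
  obtain B where B: "B > 0" "\<And>n. rat_abs2 (Y n) \<le> B" using cauchy2_bounded[OF Y] by blast
  have "e / B > 0" "e / A > 0" using e A B by auto
  then obtain N M where
    N: "\<And>m n. m \<ge> N \<Longrightarrow> n \<ge> N \<Longrightarrow> rat_abs2 (X m - X n) < e / B" and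
    M: "\<And>m n. m \<ge> M \<Longrightarrow> n \<ge> M \<Longrightarrow> rat_abs2 (Y m - Y n) < e / A"
    using X Y unfolding cauchy2_def by meson
  have "rat_abs2 (X m * Y m - X n * Y n) < e" if mn: "m \<ge> max N M" "n \<ge> max N M" for m n
  proof -
    have 1: "rat_abs2 (X m * (Y m - Y n)) < e"
    proof -
      have "rat_abs2 (X m) * rat_abs2 (Y m - Y n) \<le> A * rat_abs2 (Y m - Y n)"
        using A by (intro mult_right_mono) auto
      also have "\<dots> < A * (e / A)" using M[of m n] mn A by (intro mult_strict_left_mono) auto
      finally show ?thesis using A by simp
    qed
    have 2: "rat_abs2 ((X m - X n) * Y n) < e"
    proof -
      have "rat_abs2 (X m - X n) * rat_abs2 (Y n) \<le> rat_abs2 (X m - X n) * B"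
        using B by (intro mult_left_mono) auto
      also have "\<dots> < e / B * B" using N[of m n] mn B by (intro mult_strict_right_mono) auto
      finally show ?thesis using B by simp
    qed
    have "X m * Y m - X n * Y n = X m * (Y m - Y n) + (X m - X n) * Y n"
      by (simp add: algebra_simps)
    then show ?thesis
      using rat_abs2_add_le_max[of "X m * (Y m - Y n)" "(X m - X n) * Y n"] 1 2 by auto
  qed
  then show "\<exists>N. \<forall>m\<ge>N. \<forall>n\<ge>N. rat_abs2 (X m * Y m - X n * Y n) < e" by blast
qed

lemma cauchy2_away_from_0:
  assumes "cauchy2 X" "\<not> null2 X"
  obtains b N where "b > 0" "\<And>n. n \<ge> N \<Longrightarrow> b < rat_abs2 (X n)"
proof -
  define L where "L = lim (\<lambda>n. rat_abs2 (X n))"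
  have t: "(\<lambda>n. rat_abs2 (X n)) \<longlonglongrightarrow> L" using cauchy2_abs_tendsto[OF assms(1)] by (simp add: L_def)
  have "L \<ge> 0" using t by (rule LIMSEQ_le_const) auto
  moreover have "L \<noteq> 0" using t assms(2) by (auto simp: null2_def)
  ultimately have "L / 2 < L" "L / 2 > 0" by auto
  then obtain N where "\<And>n. n \<ge> N \<Longrightarrow> L / 2 < rat_abs2 (X n)"
    using order_tendstoD(1)[OF t \<open>L / 2 < L\<close>] by (auto simp: eventually_sequentially)
  with \<open>L / 2 > 0\<close> show ?thesis by (rule that)
qed

lemma rat_abs2_inverse_diff:
  assumes "x \<noteq> 0" "y \<noteq> 0"
  shows "rat_abs2 (inverse x - inverse y) = rat_abs2 (x - y) * inverse (rat_abs2 x) * inverse (rat_abs2 y)"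
proof -
  have "inverse x - inverse y = (y - x) * inverse x * inverse y"
    using assms by (simp add: field_simps)
  then show ?thesis by (simp add: rat_abs2_minus_commute)
qed

lemma cauchy2_inverse:
  assumes "cauchy2 X" "\<not> null2 X"
  shows "cauchy2 (\<lambda>n. inverse (X n))"
  unfolding cauchy2_def
proof (intro allI impI)
  fix e :: real assume e: "e > 0"
  obtain b N where b: "b > 0" "\<And>n. n \<ge> N \<Longrightarrow> b < rat_abs2 (X n)"
    using cauchy2_away_from_0[OF assms] by blast
  have "e * b * b > 0" using e b by simp
  then obtain M where M: "\<And>m n. m \<ge> M \<Longrightarrow> n \<ge> M \<Longrightarrow> rat_abs2 (X m - X n) < e * b * b"
    using assms(1) unfolding cauchy2_def by meson
  have "rat_abs2 (inverse (X m) - inverse (X n)) < e" if mn: "m \<ge> max N M" "n \<ge> max N M" for m n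
  proof -
    have bm: "b < rat_abs2 (X m)" and bn: "b < rat_abs2 (X n)" using b mn by auto
    then have nz: "X m \<noteq> 0" "X n \<noteq> 0" using b(1) by auto
    have "rat_abs2 (X m - X n) < e * b * b" using M mn by simp
    also have "\<dots> \<le> e * rat_abs2 (X m) * rat_abs2 (X n)"
      using bm bn b(1) e by (intro mult_mono) auto
    finally have lt: "rat_abs2 (X m - X n) < e * rat_abs2 (X m) * rat_abs2 (X n)" .
    have "rat_abs2 (X m) > 0" "rat_abs2 (X n) > 0" using bm bn b(1) by linarith+
    with lt show ?thesis
      unfolding rat_abs2_inverse_diff[OF nz] by (simp add: field_simps)
  qed
  then show "\<exists>N. \<forall>m\<ge>N. \<forall>n\<ge>N. rat_abs2 (inverse (X m) - inverse (X n)) < e" by blast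
qed

lemma null2_diff_inverse:
  assumes X: "cauchy2 X" "\<not> null2 X" and Y: "cauchy2 Y" "\<not> null2 Y"
    and d: "null2 (\<lambda>n. X n - Y n)"
  shows "null2 (\<lambda>n. inverse (X n) - inverse (Y n))"
proof -
  obtain b N where b: "b > 0" "\<And>n. n \<ge> N \<Longrightarrow> b < rat_abs2 (X n)"
    using cauchy2_away_from_0[OF X] by blast
  obtain c M where c: "c > 0" "\<And>n. n \<ge> M \<Longrightarrow> c < rat_abs2 (Y n)"
    using cauchy2_away_from_0[OF Y] by blast
  have "null2 (\<lambda>n. (inverse (X n) * inverse (Y n)) * (X n - Y n))"
    using d by (intro null2_mult cauchy2_mult cauchy2_inverse X Y)
  moreover have "eventually (\<lambda>n. rat_abs2 ((inverse (X n) * inverse (Y n)) * (X n - Y n))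
      = rat_abs2 (inverse (X n) - inverse (Y n))) sequentially"
    unfolding eventually_sequentially
  proof (intro exI allI impI)
    fix n assume n: "max N M \<le> n"
    then have "X n \<noteq> 0" "Y n \<noteq> 0" using b(2)[of n] c(2)[of n] b(1) c(1) by auto
    then show "rat_abs2 ((inverse (X n) * inverse (Y n)) * (X n - Y n))
      = rat_abs2 (inverse (X n) - inverse (Y n))"
      by (simp add: rat_abs2_inverse_diff)
  qed
  ultimately show ?thesis unfolding null2_def using tendsto_cong by fast
qed

lemma null2_cong_diff: "null2 (\<lambda>n. X n - Y n) \<Longrightarrow> null2 X \<longleftrightarrow> null2 Y"
  using null2_add[of "\<lambda>n. X n - Y n" Y] null2_diff[of X "\<lambda>n. X n - Y n"] by auto

lemma part_equivp_q2_rel: "part_equivp q2_rel"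
proof (rule part_equivpI)
  show "\<exists>X. q2_rel X X" by (rule exI[of _ "\<lambda>_. 0"]) (simp add: q2_rel_def)
  show "symp q2_rel"
    by (rule sympI) (auto simp: q2_rel_def dest: null2_minus[THEN iffD2])
  show "transp q2_rel"
  proof (rule transpI)
    fix X Y Z assume "q2_rel X Y" "q2_rel Y Z"
    then show "q2_rel X Z"
      using null2_add[of "\<lambda>n. X n - Y n" "\<lambda>n. Y n - Z n"] by (simp add: q2_rel_def)
  qed
qed

quotient_type q2 = "nat \<Rightarrow> rat" / partial: q2_rel
  by (rule part_equivp_q2_rel)

lemma cr_q2_cauchy2: "q2_rel X X \<longleftrightarrow> cauchy2 X"
  by (simp add: q2_rel_def)

instantiation q2 :: field
begin

lift_definition zero_q2 :: q2 is "\<lambda>_. 0" by (simp add: q2_rel_def)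

lift_definition one_q2 :: q2 is "\<lambda>_. 1" by (simp add: q2_rel_def)

lift_definition plus_q2 :: "q2 \<Rightarrow> q2 \<Rightarrow> q2" is "\<lambda>X Y n. X n + Y n"
proof -
  fix X Y X' Y' assume "q2_rel X X'" "q2_rel Y Y'"
  then show "q2_rel (\<lambda>n. X n + Y n) (\<lambda>n. X' n + Y' n)"
    using null2_add[of "\<lambda>n. X n - X' n" "\<lambda>n. Y n - Y' n"]
    by (auto simp: q2_rel_def cauchy2_add algebra_simps)
qed

lift_definition uminus_q2 :: "q2 \<Rightarrow> q2" is "\<lambda>X n. - X n"
proof -
  fix X X' assume "q2_rel X X'"
  then show "q2_rel (\<lambda>n. - X n) (\<lambda>n. - X' n)"
    using null2_minus[of "\<lambda>n. X n - X' n"]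
    by (auto simp: q2_rel_def cauchy2_minus algebra_simps)
qed

lift_definition times_q2 :: "q2 \<Rightarrow> q2 \<Rightarrow> q2" is "\<lambda>X Y n. X n * Y n"
proof -
  fix X Y X' Y' assume a: "q2_rel X X'" "q2_rel Y Y'"
  then have "null2 (\<lambda>n. X n * (Y n - Y' n) + Y' n * (X n - X' n))"
    by (intro null2_add null2_mult) (auto simp: q2_rel_def)
  then show "q2_rel (\<lambda>n. X n * Y n) (\<lambda>n. X' n * Y' n)"
    using a by (auto simp: q2_rel_def cauchy2_mult algebra_simps)
qed

lift_definition inverse_q2 :: "q2 \<Rightarrow> q2"
  is "\<lambda>X. if null2 X then (\<lambda>_. 0) else (\<lambda>n. inverse (X n))"
proof -
  fix X Y assume "q2_rel X Y"
  then have "cauchy2 X" "cauchy2 Y" "null2 (\<lambda>n. X n - Y n)" by (auto simp: q2_rel_def)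
  moreover from this have "null2 X \<longleftrightarrow> null2 Y" using null2_cong_diff by blast
  ultimately show "q2_rel (if null2 X then (\<lambda>_. 0) else (\<lambda>n. inverse (X n)))
                          (if null2 Y then (\<lambda>_. 0) else (\<lambda>n. inverse (Y n)))"
    by (simp add: q2_rel_def cauchy2_inverse null2_diff_inverse)
qed

definition minus_q2 :: "q2 \<Rightarrow> q2 \<Rightarrow> q2" where "minus_q2 x y = x + - y"

definition divide_q2 :: "q2 \<Rightarrow> q2 \<Rightarrow> q2" where "divide_q2 x y = x * inverse y"

instance
proof
  fix x y z :: q2
  show "x * y * z = x * (y * z)"
    by transfer (simp add: q2_rel_def cauchy2_mult algebra_simps)
  show "x * y = y * x"
    by transfer (simp add: q2_rel_def cauchy2_mult algebra_simps)
  show "1 * x = x"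
    by transfer (simp add: q2_rel_def)
  show "x + y + z = x + (y + z)"
    by transfer (simp add: q2_rel_def cauchy2_add algebra_simps)
  show "x + y = y + x"
    by transfer (simp add: q2_rel_def cauchy2_add algebra_simps)
  show "0 + x = x"
    by transfer (simp add: q2_rel_def)
  show "- x + x = 0"
    by transfer (simp add: q2_rel_def)
  show "x - y = x + - y"
    by (rule minus_q2_def)
  show "(x + y) * z = x * z + y * z"
    by transfer (simp add: q2_rel_def cauchy2_mult cauchy2_add algebra_simps)
  show "(0::q2) \<noteq> 1"
    by transfer (simp add: q2_rel_def)
  show "inverse (0::q2) = 0"
    by transfer (simp add: q2_rel_def)
  show "x div y = x * inverse y"
    by (rule divide_q2_def)
  show "x \<noteq> 0 \<Longrightarrow> inverse x * x = 1"
  proof transfer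
    fix X assume a: "q2_rel X X" "\<not> q2_rel X (\<lambda>_. 0)"
    then have X: "cauchy2 X" "\<not> null2 X" by (auto simp: q2_rel_def)
    obtain b N where b: "b > 0" "\<And>n. n \<ge> N \<Longrightarrow> b < rat_abs2 (X n)"
      using cauchy2_away_from_0[OF X] by blast
    have "eventually (\<lambda>n. rat_abs2 (inverse (X n) * X n - 1) = 0) sequentially"
      unfolding eventually_sequentially
    proof (intro exI allI impI)
      fix n assume "N \<le> n"
      then have "X n \<noteq> 0" using b(2)[of n] b(1) by auto
      then show "rat_abs2 (inverse (X n) * X n - 1) = 0" by simp
    qed
    then have "null2 (\<lambda>n. inverse (X n) * X n - 1)"
      unfolding null2_def by (rule tendsto_eventually)
    then show "q2_rel (\<lambda>n. (if null2 X then \<lambda>_. 0 else (\<lambda>n. inverse (X n))) n * X n) (\<lambda>_. 1)"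
      using X by (simp add: q2_rel_def cauchy2_mult cauchy2_inverse)
  qed
qed

end

lemma of_nat_q2_transfer: "of_nat n = abs_q2 (\<lambda>_. of_nat n)"
proof (induction n)
  case 0
  show ?case by (simp add: zero_q2_def)
next
  case (Suc n)
  have "abs_q2 (\<lambda>_. 1) + abs_q2 (\<lambda>_. of_nat n) = abs_q2 (\<lambda>_. 1 + of_nat n)"
    by (rule plus_q2.abs_eq) (simp_all add: cr_q2_cauchy2)
  then show ?case by (simp add: Suc one_q2_def)
qed

instance q2 :: field_char_0
proof
  show "inj (of_nat :: nat \<Rightarrow> q2)"
  proof (rule injI)
    fix m n assume "(of_nat m :: q2) = of_nat n"
    then have "q2_rel (\<lambda>_. of_nat m) (\<lambda>_. of_nat n)"
      using Quotient3_rel[OF Quotient3_q2, of "\<lambda>_. of_nat m" "\<lambda>_. of_nat n"]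
      by (simp add: of_nat_q2_transfer cr_q2_cauchy2)
    then show "m = n" by (simp add: q2_rel_def)
  qed
qed

text \<open>The class \<open>norm\<close> is not instantiated because \<open>norm\<close> is reserved for real normed spaces.\<close>

lift_definition q2_abs :: "q2 \<Rightarrow> real" is "\<lambda>X. lim (\<lambda>n. rat_abs2 (X n))"
proof -
  fix X Y assume a: "q2_rel X Y"
  have "(\<lambda>n. rat_abs2 (X n) - rat_abs2 (Y n)) \<longlonglongrightarrow> 0"
  proof (rule tendsto_rabs_zero_cancel)
    have "(\<lambda>n. rat_abs2 (X n - Y n)) \<longlonglongrightarrow> 0" using a by (simp add: q2_rel_def null2_def)
    then show "(\<lambda>n. \<bar>rat_abs2 (X n) - rat_abs2 (Y n)\<bar>) \<longlonglongrightarrow> 0"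
      by (rule squeeze_0) (auto simp: rat_abs2_diff_le)
  qed
  moreover have "(\<lambda>n. rat_abs2 (X n) - rat_abs2 (Y n)) \<longlonglongrightarrow>
      lim (\<lambda>n. rat_abs2 (X n)) - lim (\<lambda>n. rat_abs2 (Y n))"
    using a by (intro tendsto_diff cauchy2_abs_tendsto) (auto simp: q2_rel_def)
  ultimately show "lim (\<lambda>n. rat_abs2 (X n)) = lim (\<lambda>n. rat_abs2 (Y n))"
    using LIMSEQ_unique by fastforce
qed

lemma q2_abs_eq_0 [simp]: "q2_abs (x::q2) = 0 \<longleftrightarrow> x = 0"
proof transfer
  fix X assume "q2_rel X X"
  then have X: "cauchy2 X" by (simp add: q2_rel_def)
  show "lim (\<lambda>n. rat_abs2 (X n)) = 0 \<longleftrightarrow> q2_rel X (\<lambda>_. 0)"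
  proof
    assume "lim (\<lambda>n. rat_abs2 (X n)) = 0"
    then show "q2_rel X (\<lambda>_. 0)"
      using X cauchy2_abs_tendsto[OF X] by (simp add: q2_rel_def null2_def)
  next
    assume "q2_rel X (\<lambda>_. 0)"
    then have "(\<lambda>n. rat_abs2 (X n)) \<longlonglongrightarrow> 0" by (simp add: q2_rel_def null2_def)
    then show "lim (\<lambda>n. rat_abs2 (X n)) = 0" by (rule limI)
  qed
qed

lemma q2_abs_nonneg [simp]: "q2_abs (x::q2) \<ge> 0"
proof transfer
  fix X assume "q2_rel X X"
  then have X: "cauchy2 X" by (simp add: q2_rel_def)
  show "0 \<le> lim (\<lambda>n. rat_abs2 (X n))"
    by (rule LIMSEQ_le_const[OF cauchy2_abs_tendsto[OF X]]) auto
qed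

lemma q2_abs_mult: "q2_abs (x * y :: q2) = q2_abs x * q2_abs y"
proof transfer
  fix X Y assume "q2_rel X X" "q2_rel Y Y"
  then have "cauchy2 X" "cauchy2 Y" by (auto simp: q2_rel_def)
  then have "(\<lambda>n. rat_abs2 (X n) * rat_abs2 (Y n)) \<longlonglongrightarrow>
      lim (\<lambda>n. rat_abs2 (X n)) * lim (\<lambda>n. rat_abs2 (Y n))"
    by (intro tendsto_mult cauchy2_abs_tendsto)
  then show "lim (\<lambda>n. rat_abs2 (X n * Y n)) = lim (\<lambda>n. rat_abs2 (X n)) * lim (\<lambda>n. rat_abs2 (Y n))"
    unfolding rat_abs2_mult by (rule limI)
qed

lemma q2_abs_add_le_max: "q2_abs (x + y :: q2) \<le> max (q2_abs x) (q2_abs y)"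
proof transfer
  fix X Y assume "q2_rel X X" "q2_rel Y Y"
  then have XY: "cauchy2 X" "cauchy2 Y" by (auto simp: q2_rel_def)
  show "lim (\<lambda>n. rat_abs2 (X n + Y n)) \<le> max (lim (\<lambda>n. rat_abs2 (X n))) (lim (\<lambda>n. rat_abs2 (Y n)))"
  proof (rule LIMSEQ_le)
    show "(\<lambda>n. rat_abs2 (X n + Y n)) \<longlonglongrightarrow> lim (\<lambda>n. rat_abs2 (X n + Y n))"
      by (intro cauchy2_abs_tendsto cauchy2_add XY)
    show "(\<lambda>n. max (rat_abs2 (X n)) (rat_abs2 (Y n))) \<longlonglongrightarrow>
        max (lim (\<lambda>n. rat_abs2 (X n))) (lim (\<lambda>n. rat_abs2 (Y n)))"
      by (intro tendsto_max cauchy2_abs_tendsto XY)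
  qed (auto intro: rat_abs2_add_le_max)
qed

lemma q2_abs_minus [simp]: "q2_abs (- x :: q2) = q2_abs x"
  by transfer (simp add: q2_rel_def)

lemma q2_abs_of_rat: "q2_abs (of_rat q :: q2) = rat_abs2 q"
proof -
  have n: "q2_abs (of_nat n :: q2) = rat_abs2 (of_nat n)" for n
    by (simp add: of_nat_q2_transfer q2_abs.abs_eq cr_q2_cauchy2)
  have i: "q2_abs (of_int k :: q2) = rat_abs2 (of_int k)" for k
    by (cases k rule: int_cases2) (auto simp: n)
  obtain a b where q: "q = of_int a / of_int b" "b \<noteq> 0" by (rule rat_quotientE)
  then have "q * of_int b = of_int a" by simp
  then have "rat_abs2 q * rat_abs2 (of_int b) = rat_abs2 (of_int a)"
    by (metis rat_abs2_mult)
  moreover have "(of_rat q :: q2) * of_int b = of_int a"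
    using q by (simp add: of_rat_divide)
  then have "q2_abs (of_rat q :: q2) * q2_abs (of_int b :: q2) = q2_abs (of_int a :: q2)"
    by (metis q2_abs_mult)
  ultimately show ?thesis using q(2) by (simp add: i) (metis mult_right_cancel of_int_eq_0_iff rat_abs2_eq_0)
qed

instantiation q2 :: metric_space
begin

definition dist_q2 :: "q2 \<Rightarrow> q2 \<Rightarrow> real" where "dist_q2 x y = q2_abs (x - y)"

definition uniformity_q2 :: "(q2 \<times> q2) filter" where
  "uniformity_q2 = (INF e\<in>{0<..}. principal {(x, y). dist x y < e})"

definition open_q2 :: "q2 set \<Rightarrow> bool" where
  "open_q2 U \<longleftrightarrow> (\<forall>x\<in>U. eventually (\<lambda>(x', y). x' = x \<longrightarrow> y \<in> U) uniformity)"

instance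
proof
  fix x y z :: q2
  show "dist x y = 0 \<longleftrightarrow> x = y" by (simp add: dist_q2_def)
  have "q2_abs (y - z) = q2_abs (z - y)" using q2_abs_minus[of "y - z"] by simp
  moreover have "q2_abs (x - y) \<le> max (q2_abs (x - z)) (q2_abs (z - y))"
    using q2_abs_add_le_max[of "x - z" "z - y"] by simp
  ultimately show "dist x y \<le> dist x z + dist y z"
    using q2_abs_nonneg[of "x - z"] q2_abs_nonneg[of "z - y"]
    unfolding dist_q2_def by linarith
qed (simp_all add: uniformity_q2_def open_q2_def)

end

definition vnorm :: "q2 ^ 'n::finite \<Rightarrow> real" where
  "vnorm x = Max (range (\<lambda>\<nu>. q2_abs (x $ \<nu>)))"

definition vdot :: "q2 ^ 'n::finite \<Rightarrow> q2 ^ 'n \<Rightarrow> q2" where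
  "vdot \<xi> x = (\<Sum>\<nu>\<in>UNIV. \<xi> $ \<nu> * x $ \<nu>)"

text \<open>The product topology makes \<open>q2 ^ 'n\<close> second countable, so a translation-invariant Borel
  measure giving the unit ball mass \<open>1\<close> is unique; it is the product of the normalized Haar measures.\<close>

definition haar :: "(q2 ^ 'n::finite) measure" where
  "haar = (THE M. sets M = sets borel \<and>
                  (\<forall>a. distr M borel (\<lambda>x. a + x) = M) \<and>
                  emeasure M {x. vnorm x \<le> 1} = 1)"

text \<open>The fractional part is the rational \<open>m / 2\<^sup>k\<close> in \<open>[0,1)\<close> that differs from \<open>t\<close> by a 2-adic integer.\<close>

definition frac2 :: "q2 \<Rightarrow> rat" where
  "frac2 t = (THE r. (\<exists>m k :: nat. r = of_nat m / 2 ^ k) \<and> r < 1 \<and> q2_abs (t - of_rat r) \<le> 1)"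

definition chi2 :: "q2 \<Rightarrow> complex" where
  "chi2 t = exp (2 * of_real pi * \<i> * of_rat (frac2 t))"

definition Omega :: "real \<Rightarrow> complex" where
  "Omega t = (if 0 \<le> t \<and> t \<le> 1 then 1 else 0)"

definition fourier :: "(q2 ^ 'n::finite \<Rightarrow> complex) \<Rightarrow> (q2 ^ 'n \<Rightarrow> complex)" where
  "fourier \<phi> \<xi> = (LINT x|haar. chi2 (vdot \<xi> x) * \<phi> x)"

definition inv_fourier :: "(q2 ^ 'n::finite \<Rightarrow> complex) \<Rightarrow> (q2 ^ 'n \<Rightarrow> complex)" where
  "inv_fourier \<phi> x = (LINT \<xi>|haar. chi2 (vdot (- x) \<xi>) * \<phi> \<xi>)"

definition locally_constant :: "('a::topological_space \<Rightarrow> 'b) \<Rightarrow> bool" where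
  "locally_constant f \<longleftrightarrow> (\<forall>x. \<exists>U. open U \<and> x \<in> U \<and> f constant_on U)"

definition lizorkin :: "(q2 ^ 'n::finite \<Rightarrow> complex) set" where
  "lizorkin = {\<phi>. locally_constant \<phi> \<and> compact (closure {x. \<phi> x \<noteq> 0}) \<and>
                  (LINT x|haar. \<phi> x) = 0}"

text \<open>At \<open>\<xi> = 0\<close> the symbol is \<open>0 powr \<alpha>\<close>, which is \<open>0\<close> for every \<open>\<alpha>\<close> (also \<open>\<alpha> = 0\<close>),
  so the product vanishes there, as required.\<close>

definition taibleson :: "complex \<Rightarrow> (q2 ^ 'n::finite \<Rightarrow> complex) \<Rightarrow> (q2 ^ 'n \<Rightarrow> complex)" where
  "taibleson \<alpha> \<phi> = inv_fourier (\<lambda>\<xi>. (of_real (vnorm \<xi>) powr \<alpha>) * fourier \<phi> \<xi>)"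

definition eigenfunction_on ::
  "('a \<Rightarrow> complex) set \<Rightarrow> (('a \<Rightarrow> complex) \<Rightarrow> ('a \<Rightarrow> complex)) \<Rightarrow> ('a \<Rightarrow> complex) \<Rightarrow> complex \<Rightarrow> bool" where
  "eigenfunction_on V T f c \<longleftrightarrow> f \<in> V \<and> f \<noteq> (\<lambda>x. 0) \<and> T f = (\<lambda>x. c * f x)"

definition I2 :: "q2 set" where
  "I2 = {2 powi (- int \<gamma>) * (\<Sum>i<\<gamma>. of_nat (d i) * 2 ^ i) | (\<gamma>::nat) (d :: nat \<Rightarrow> nat).
           \<gamma> \<ge> 1 \<and> (\<forall>i. d i \<in> {0, 1})}"

definition kvec :: "'n set \<Rightarrow> 'n \<Rightarrow> nat" where
  "kvec e \<nu> = (if \<nu> \<in> e then 1 else 0)"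

definition Psi0 :: "'n set \<Rightarrow> q2 ^ 'n::finite \<Rightarrow> complex" where
  "Psi0 e x = chi2 (inverse 2 * vdot (\<chi> \<nu>. of_nat (kvec e \<nu>)) x) * Omega (vnorm x)"

text \<open>\<open>A i k\<close> is the coefficient with superscript \<open>i \<in> {0, 1}\<close> and subscript \<open>k < 2\<^sup>s\<close>;
  other values of \<open>A\<close> are irrelevant.\<close>

definition admissible :: "nat \<Rightarrow> (nat \<Rightarrow> nat \<Rightarrow> complex) \<Rightarrow> bool" where
  "admissible s A \<longleftrightarrow>
     (if s \<ge> 1 then
        \<exists>\<gamma> :: nat \<Rightarrow> complex. (\<forall>r<2 ^ s. cmod (\<gamma> r) = 1) \<and>
          (\<forall>k<2 ^ s. A 1 k = 1 / 2 ^ s * (-1) ^ k *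
             (\<Sum>r<2 ^ s. \<gamma> r * exp (- \<i> * of_real pi * ((2 * of_nat r + 1) / 2 ^ s) * of_nat k)))
      else A 1 0 = 1) \<and>
     A 0 0 = 1 \<and> (\<forall>k\<in>{1..<2 ^ s}. A 0 k = 0)"

definition Psi ::
  "('n \<Rightarrow> nat) \<Rightarrow> ('n \<Rightarrow> nat \<Rightarrow> nat \<Rightarrow> complex) \<Rightarrow> 'n set \<Rightarrow> int \<Rightarrow> q2 ^ 'n::finite \<Rightarrow> q2 ^ 'n \<Rightarrow> complex" where
  "Psi s A e j a x =
     of_real (2 powr (- (real CARD('n) * real_of_int j / 2))) *
     (\<Sum>r \<in> {r. \<forall>\<nu>. r \<nu> < 2 ^ s \<nu>}.
        (\<Prod>\<nu>\<in>UNIV. A \<nu> (kvec e \<nu>) (r \<nu>)) *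
        Psi0 e ((2 powi j) *s x - a - (\<chi> \<nu>. of_nat (r \<nu>) / 2 ^ s \<nu> * of_nat (kvec e \<nu>))))"

end

theory Submission
  imports Defs
begin

text \<open>Up to constant factors, each term of \<open>\<Psi>\<close> is the additive character of frequency
  \<open>\<eta> = 2\<^sup>j\<^sup>-\<^sup>1 k\<^sub>e\<close> restricted to a ball of radius \<open>2\<^sup>j\<close>. A nontrivial character
  integrates to \<open>0\<close> over a ball, so the Fourier transform of such a term is supported in the ball
  of radius \<open>2\<^sup>-\<^sup>j\<close> around \<open>-\<eta>\<close>. Since \<open>|\<eta>| = 2\<^sup>1\<^sup>-\<^sup>j\<close>, the ultrametric inequality makes the symbol
  constant on that ball, and Fourier inversion for these terms is the same computation again.
  The translates that occur with nonzero coefficient have pairwise disjoint supports, so \<open>\<Psi>\<close> is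
  nonzero as soon as one coefficient is.

  The Haar measure is obtained from Lebesgue measure by reading the binary digits of a real number
  as the digits of a 2-adic number; it is unique because balls form a generating family closed
  under intersection.\<close>

section \<open>Arithmetic and completeness of the 2-adic numbers\<close>

text \<open>Two definite descriptions block every computation. \<open>haar\<close> has a usable
  value only once an invariant normalized measure is known to exist and to be unique, and
  \<open>frac2\<close>, hence \<open>chi2\<close>, only once each coset of the 2-adic integers is
  known to contain exactly one dyadic fraction in [0,1). Both facts come from residues modulo
  \<open>2 ^ k\<close>; completeness serves the compactness of balls, which membership in
  \<open>lizorkin\<close> requires.

  No general inversion theorem is used. The transform of a character cut off to a ball is again such
  a function, with centre and frequency exchanged up to sign, so one integral formula yields the
  transform and its inverse. All terms of \<open>Psi\<close> share one frequency and one radius,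
  hence their transforms live on the same ball and the symbol leaves the whole sum as a single
  factor. The strict gap between the radius of that ball and the norm of its centre comes from the
  factor 1/2 in \<open>Psi0\<close>; it gives the constant symbol and also the vanishing
  mean.\<close>

lemma power_int_le_iff_real [simp]: "(2::real) powi a \<le> 2 powi b \<longleftrightarrow> a \<le> b"
  by (smt (verit) power_int_increasing power_int_strict_increasing)

lemma rat_abs2_of_int_le_iff: "rat_abs2 (of_int a) \<le> 2 powi (- int k) \<longleftrightarrow> 2 ^ k dvd a"
proof (cases "a = 0")
  case False
  then have "rat_abs2 (of_int a) = 2 powi (- int (multiplicity 2 a))"
    using rat_abs2_divide[of a 1] by simp
  then show ?thesis
    using False by (simp add: power_dvd_iff_le_multiplicity del: power_int_minus)
qed simp

lemma rat_abs2_2: "rat_abs2 2 = 1 / 2"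
  using rat_abs2_divide[of 2 1] by simp

lemma q2_abs_of_int_le_iff: "q2_abs (of_int a) \<le> 2 powi (- int k) \<longleftrightarrow> 2 ^ k dvd a"
  using rat_abs2_of_int_le_iff[of a k] q2_abs_of_rat[of "of_int a"] by simp

lemma q2_abs_0 [simp]: "q2_abs 0 = 0" and q2_abs_1 [simp]: "q2_abs 1 = 1"
  using q2_abs_of_rat[of 1] by simp_all

lemma q2_abs_2: "q2_abs 2 = 1 / 2"
  using q2_abs_of_rat[of 2] rat_abs2_2 by simp

lemma q2_abs_inverse: "q2_abs (inverse x) = inverse (q2_abs x)"
proof (cases "x = 0")
  case False
  then have "q2_abs x * q2_abs (inverse x) = 1"
    by (simp flip: q2_abs_mult)
  then show ?thesis by (metis inverse_unique)
qed simp

lemma q2_abs_divide: "q2_abs (x / y) = q2_abs x / q2_abs y"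
  by (simp add: divide_inverse q2_abs_mult q2_abs_inverse)

lemma q2_abs_power: "q2_abs (x ^ k) = q2_abs x ^ k"
  by (induction k) (simp_all add: q2_abs_mult)

lemma q2_abs_2_powi: "q2_abs (2 powi k) = 2 powi (- k)"
  by (auto simp: power_int_def q2_abs_power q2_abs_divide q2_abs_2 inverse_eq_divide)

lemma q2_abs_minus_commute: "q2_abs (x - y) = q2_abs (y - x)"
  using q2_abs_minus[of "x - y"] by simp

lemma q2_abs_add_le:
  "q2_abs x \<le> r \<Longrightarrow> q2_abs y \<le> r \<Longrightarrow> q2_abs (x + y) \<le> r"
  using q2_abs_add_le_max[of x y] by linarith

lemma q2_abs_diff_le:
  "q2_abs x \<le> r \<Longrightarrow> q2_abs y \<le> r \<Longrightarrow> q2_abs (x - y) \<le> r"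
  using q2_abs_add_le[of x r "- y"] by simp

lemma q2_abs_of_int_le_1: "q2_abs (of_int a) \<le> 1"
  using q2_abs_of_int_le_iff[of a 0] by simp

lemma q2_abs_sum_le: "(\<And>i. i \<in> I \<Longrightarrow> q2_abs (f i) \<le> r) \<Longrightarrow> 0 \<le> r \<Longrightarrow> q2_abs (sum f I) \<le> r"
  by (induction I rule: infinite_finite_induct) (auto intro: q2_abs_add_le)

section \<open>Rational approximation and completeness\<close>

lemma abs_q2_diff:
  assumes "cauchy2 X" "cauchy2 Y"
  shows "abs_q2 X - abs_q2 Y = abs_q2 (\<lambda>n. X n - Y n)"
  using assms by (simp add: minus_q2_def uminus_q2.abs_eq plus_q2.abs_eq cr_q2_cauchy2 cauchy2_minus)

lemma of_rat_q2_transfer: "of_rat q = abs_q2 (\<lambda>_. q)"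
proof -
  obtain a b where q: "q = of_int a / of_int b" "b \<noteq> 0" by (rule rat_quotientE)
  have i: "of_int k = abs_q2 (\<lambda>_. of_int k)" for k
    by (cases k rule: int_cases2) (simp_all add: of_nat_q2_transfer uminus_q2.abs_eq cr_q2_cauchy2)
  have "abs_q2 (\<lambda>_. q) * of_int b = abs_q2 (\<lambda>_. q * of_int b)"
    unfolding i by (rule times_q2.abs_eq) (simp_all add: cr_q2_cauchy2)
  also have "\<dots> = of_int a" using q by (simp add: i)
  finally have "abs_q2 (\<lambda>_. q) * of_int b = of_int a" .
  moreover have "of_rat q * of_int b = (of_int a :: q2)"
    using q by (simp add: of_rat_divide)
  ultimately show ?thesis using q(2) by (metis mult_right_cancel of_int_eq_0_iff)
qed

text \<open>Links the quotient construction to the metric: density of the rationals and completeness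
  both follow from it.\<close>

lemma abs_q2_limit:
  assumes X: "cauchy2 X" and e: "e > 0"
  shows "\<exists>N. \<forall>n\<ge>N. q2_abs (abs_q2 X - of_rat (X n)) < e"
proof -
  \<comment> \<open>Half of \<open>e\<close>, because passing to the limit preserves only the weak
    inequality.\<close>
  obtain N where N: "\<And>m n. m \<ge> N \<Longrightarrow> n \<ge> N \<Longrightarrow> rat_abs2 (X m - X n) < e / 2"
    using X half_gt_zero[OF e] unfolding cauchy2_def by meson
  have "q2_abs (abs_q2 X - of_rat (X n)) < e" if n: "n \<ge> N" for n
  proof -
    have c: "cauchy2 (\<lambda>k. X k - X n)" using X by (intro cauchy2_diff) auto
    have "q2_abs (abs_q2 X - of_rat (X n)) = lim (\<lambda>k. rat_abs2 (X k - X n))"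
      using c X by (simp add: of_rat_q2_transfer abs_q2_diff q2_abs.abs_eq cr_q2_cauchy2)
    also have "\<dots> \<le> e / 2"
      using n N by (intro LIMSEQ_le_const2[OF cauchy2_abs_tendsto[OF c]]) (auto intro!: exI[of _ N] less_imp_le)
    finally show ?thesis using e by simp
  qed
  then show ?thesis by blast
qed

lemma q2_rat_dense:
  assumes "e > 0"
  obtains q where "q2_abs (x - of_rat q) < e"
proof -
  obtain X where "q2_rel X X" "abs_q2 X = x"
    using Quotient3_rep_reflp[OF Quotient3_q2] Quotient3_abs_rep[OF Quotient3_q2] by blast
  then show ?thesis using abs_q2_limit[of X e] that assms cr_q2_cauchy2 by blast
qed

text \<open>Replace each \<open>x n\<close> by a rational \<open>q n\<close> within
  \<open>1 / (n + 1)\<close>. The ultrametric inequality makes \<open>q\<close> Cauchy, and the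
  class of \<open>q\<close> is the limit.\<close>

instance q2 :: complete_space
proof
  fix x :: "nat \<Rightarrow> q2" assume x: "Cauchy x"
  have "\<forall>n. \<exists>q. q2_abs (x n - of_rat q) < inverse (real (Suc n))"
    by (metis q2_rat_dense inverse_positive_iff_positive of_nat_0_less_iff zero_less_Suc)
  then obtain q where q: "\<And>n. q2_abs (x n - of_rat (q n)) < inverse (real (Suc n))" by metis
  have q': "\<exists>N. \<forall>n\<ge>N. q2_abs (x n - of_rat (q n)) < e" if e: "e > 0" for e
  proof -
    obtain N where "inverse (real (Suc N)) < e" using reals_Archimedean[OF e] by auto
    moreover have "inverse (real (Suc n)) \<le> inverse (real (Suc N))" if "n \<ge> N" for n
      using that by (intro le_imp_inverse_le) auto
    ultimately have "q2_abs (x n - of_rat (q n)) < e" if "n \<ge> N" for n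
      using q[of n] that by (smt (verit))
    then show ?thesis by blast
  qed
  have c: "cauchy2 q"
    unfolding cauchy2_def
  proof (intro allI impI)
    fix e :: real assume e: "e > 0"
    obtain N where N: "\<And>n. n \<ge> N \<Longrightarrow> q2_abs (x n - of_rat (q n)) < e" using q'[OF e] by blast
    obtain M where M: "\<And>m n. m \<ge> M \<Longrightarrow> n \<ge> M \<Longrightarrow> q2_abs (x m - x n) < e"
      using x e unfolding Cauchy_def dist_q2_def by meson
    have "rat_abs2 (q m - q n) < e" if "m \<ge> max N M" "n \<ge> max N M" for m n
    proof -
      have "of_rat (q m - q n) = (x n - of_rat (q n)) + ((x m - x n) - (x m - of_rat (q m)))"
        by (simp add: of_rat_diff)
      then have "rat_abs2 (q m - q n) \<le> max (q2_abs (x n - of_rat (q n)))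
          (max (q2_abs (x m - x n)) (q2_abs (x m - of_rat (q m))))"
        using q2_abs_add_le_max[of "x n - of_rat (q n)" "(x m - x n) - (x m - of_rat (q m))"]
          q2_abs_add_le_max[of "x m - x n" "- (x m - of_rat (q m))"] q2_abs_minus[of "x m - of_rat (q m)"]
        by (auto simp flip: q2_abs_of_rat)
      then show ?thesis using N[of n] N[of m] M[of m n] that by auto
    qed
    then show "\<exists>N. \<forall>m\<ge>N. \<forall>n\<ge>N. rat_abs2 (q m - q n) < e" by blast
  qed
  have "x \<longlonglongrightarrow> abs_q2 q"
  proof (rule metric_LIMSEQ_I)
    fix e :: real assume e: "e > 0"
    obtain N where N: "\<And>n. n \<ge> N \<Longrightarrow> q2_abs (x n - of_rat (q n)) < e" using q'[OF e] by blast
    obtain M where M: "\<And>n. n \<ge> M \<Longrightarrow> q2_abs (abs_q2 q - of_rat (q n)) < e" using abs_q2_limit[OF c e] by blast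
    have "dist (x n) (abs_q2 q) < e" if "n \<ge> max N M" for n
      using N[of n] M[of n] that q2_abs_add_le_max[of "x n - of_rat (q n)" "- (abs_q2 q - of_rat (q n))"]
        q2_abs_minus[of "abs_q2 q - of_rat (q n)"]
      by (simp add: dist_q2_def)
    then show "\<exists>N. \<forall>n\<ge>N. dist (x n) (abs_q2 q) < e" by blast
  qed
  then show "convergent x" by (auto simp: convergent_def)
qed

section \<open>Discrete values and residues modulo powers of 2\<close>

lemma q2_abs_add_eq:
  assumes "q2_abs y < q2_abs x"
  shows "q2_abs (x + y) = q2_abs x"
  using assms q2_abs_add_le_max[of x y] q2_abs_add_le_max[of "x + y" "- y"] by simp

text \<open>A rational closer to \<open>x\<close> than \<open>q2_abs x\<close> has the same absolute
  value, so completing the rationals adds no new values.\<close>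

lemma q2_abs_cases:
  assumes "x \<noteq> 0"
  obtains k where "q2_abs x = 2 powi k"
proof -
  have pos: "q2_abs x > 0" using assms by (metis q2_abs_eq_0 q2_abs_nonneg less_eq_real_def)
  obtain q where q: "q2_abs (x - of_rat q) < q2_abs x" using q2_rat_dense[OF pos] by blast
  then have "q2_abs (x + - (x - of_rat q)) = q2_abs x"
    by (intro q2_abs_add_eq) (simp only: q2_abs_minus)
  then have "q2_abs x = rat_abs2 q" "q \<noteq> 0" using pos by (auto simp: q2_abs_of_rat)
  then show ?thesis using that by (auto simp: rat_abs2_def)
qed

lemma q2_abs_less_powi: "q2_abs x < 2 powi k \<longleftrightarrow> q2_abs x \<le> 2 powi (k - 1)"
proof (cases "x = 0")
  case False
  then obtain l where "q2_abs x = 2 powi l" by (rule q2_abs_cases)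
  then show ?thesis using power_int_le_iff_real by (smt (verit))
qed simp

text \<open>By density it is enough to treat a rational a/c in lowest terms. Integrality forces c to
  be odd.\<close>

lemma q2_residue_field:
  assumes "q2_abs u \<le> 1"
  obtains b :: nat where "b < 2" "q2_abs (u - of_nat b) \<le> 1 / 2"
proof -
  obtain q where q: "q2_abs (u - of_rat q) < 1 / 2" using q2_rat_dense[of "1 / 2" u] by auto
  have q1: "q2_abs (of_rat q) \<le> 1"
    using q2_abs_diff_le[of u 1 "u - of_rat q"] assms q by simp
  obtain a c where ac: "quotient_of q = (a, c)" by fastforce
  have qe: "q = of_int a / of_int c" and c0: "c > 0" and cop: "coprime a c"
    using ac quotient_of_div quotient_of_denom_pos quotient_of_coprime by blast+
  have e: "q * of_int c = of_int a" using qe c0 by simp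
  have oddc: "odd c"
  proof
    assume ev: "even c"
    then have "rat_abs2 (of_int c) \<le> 1 / 2" using rat_abs2_of_int_le_iff[of c 1] by simp
    then have "rat_abs2 (of_int a) \<le> 1 / 2"
      using q1 mult_mono[of "rat_abs2 q" 1 "rat_abs2 (of_int c)" "1 / 2"]
      by (simp add: q2_abs_of_rat flip: rat_abs2_mult e)
    then have "even a" using rat_abs2_of_int_le_iff[of a 1] by simp
    then show False using ev cop by (meson coprime_common_divisor odd_one)
  qed
  have c1: "rat_abs2 (of_int c) = 1"
  proof -
    have "\<not> rat_abs2 (of_int c) \<le> 2 powi (-1)" using oddc rat_abs2_of_int_le_iff[of c 1] by simp
    then show ?thesis
      using q2_abs_less_powi[of "of_int c" 0] q2_abs_of_int_le_1[of c] q2_abs_of_rat[of "of_int c"] by simp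
  qed
  \<comment> \<open>Since \<open>c\<close> is odd, a/c and \<open>a\<close> have the same residue
    modulo 2.\<close>
  define b where "b = nat (a mod 2)"
  have "2 dvd a - int b * c" using oddc unfolding b_def by (cases "even a") (auto simp: mod_2_eq_odd)
  then have "rat_abs2 (of_int (a - int b * c)) \<le> 1 / 2"
    using rat_abs2_of_int_le_iff[of "a - int b * c" 1] by simp
  moreover have "of_int (a - int b * c) = (q - of_nat b) * of_int c"
    using e by (simp add: algebra_simps)
  ultimately have "rat_abs2 (q - of_nat b) \<le> 1 / 2" using c1 by simp
  then have "q2_abs (of_rat q - of_nat b) \<le> 1 / 2"
    by (simp flip: q2_abs_of_rat add: of_rat_diff)
  then have "q2_abs (u - of_nat b) \<le> 1 / 2"
    using q2_abs_add_le[of "u - of_rat q" "1/2" "of_rat q - of_nat b"] q by simp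
  moreover have "b < 2" by (simp add: b_def nat_less_iff)
  ultimately show ?thesis using that by blast
qed

text \<open>Digit by digit: the error after \<open>k\<close> digits, divided by
  \<open>2 ^ k\<close>, is again integral, and its residue modulo 2 is the next digit.\<close>

lemma q2_integer_mod_power:
  assumes "q2_abs t \<le> 1"
  obtains m :: nat where "m < 2 ^ k" "q2_abs (t - of_nat m) \<le> 2 powi (- int k)"
  using assms
proof (induction k arbitrary: thesis)
  case 0
  show ?case using 0(1)[of 0] 0(2) by simp
next
  case (Suc k)
  obtain m :: nat where m: "m < 2 ^ k" "q2_abs (t - of_nat m) \<le> 2 powi (- int k)"
    using Suc.IH Suc.prems(2) by blast
  have "q2_abs ((t - of_nat m) / 2 ^ k) \<le> 1"
    using m(2) by (simp add: q2_abs_divide q2_abs_power q2_abs_2 power_divide power_int_minus field_simps)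
  then obtain b :: nat where b: "b < 2" "q2_abs ((t - of_nat m) / 2 ^ k - of_nat b) \<le> 1 / 2"
    by (rule q2_residue_field)
  have "t - of_nat (m + b * 2 ^ k) = 2 ^ k * ((t - of_nat m) / 2 ^ k - of_nat b)"
    by (simp add: field_simps)
  then have "q2_abs (t - of_nat (m + b * 2 ^ k)) = (1 / 2) ^ k * q2_abs ((t - of_nat m) / 2 ^ k - of_nat b)"
    by (simp add: q2_abs_mult q2_abs_power q2_abs_2)
  also have "\<dots> \<le> (1 / 2) ^ k * (1 / 2)" using b(2) by (intro mult_left_mono) auto
  also have "\<dots> = 2 powi (- int (Suc k))" 
    unfolding power_int_minus power_int_of_nat by (simp add: power_divide inverse_eq_divide)
  finally have "q2_abs (t - of_nat (m + b * 2 ^ k)) \<le> 2 powi (- int (Suc k))" .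
  moreover have "m + b * 2 ^ k < 2 ^ Suc k"
    using m(1) b(1) by (cases b) auto
  ultimately show ?case using Suc.prems(1) by blast
qed

lemma q2_integer_mod_power_unique:
  assumes "m < 2 ^ k" "m' < 2 ^ k" "q2_abs (of_nat m - of_nat m') \<le> 2 powi (- int k)"
  shows "m = m'"
proof -
  have "2 ^ k dvd int m - int m'"
    using assms(3) q2_abs_of_int_le_iff[of "int m - int m'" k] by simp
  moreover have "\<bar>int m - int m'\<bar> < 2 ^ k"
  proof -
    have "int m < int (2 ^ k)" "int m' < int (2 ^ k)" using assms(1,2) by (simp_all only: of_nat_less_iff)
    then have "\<bar>int m - int m'\<bar> < int (2 ^ k)" by linarith
    then show ?thesis by simp
  qed
  ultimately show ?thesis using zdvd_not_zless[of "\<bar>int m - int m'\<bar>" "2 ^ k"] by auto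
qed

section \<open>Balls and invariant measures\<close>

lemma vnorm_le_iff: "vnorm x \<le> r \<longleftrightarrow> (\<forall>\<nu>. q2_abs (x $ \<nu>) \<le> r)"
  unfolding vnorm_def by (subst Max_le_iff) auto

lemma q2_abs_le_vnorm: "q2_abs (x $ \<nu>) \<le> vnorm x"
  using vnorm_le_iff[of x "vnorm x"] by simp

lemma vnorm_attained: obtains \<nu> where "vnorm x = q2_abs (x $ \<nu>)"
proof -
  have "vnorm x \<in> range (\<lambda>\<nu>. q2_abs (x $ \<nu>))" unfolding vnorm_def by (rule Max_in) auto
  then show ?thesis using that by blast
qed

lemma vnorm_nonneg [simp]: "vnorm x \<ge> 0"
  using q2_abs_le_vnorm[of x undefined] q2_abs_nonneg[of "x $ undefined"] by linarith

lemma vnorm_minus_commute: "vnorm (x - y) = vnorm (y - x)"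
  by (simp add: vnorm_def q2_abs_minus_commute)

definition qball :: "q2 ^ 'n::finite \<Rightarrow> int \<Rightarrow> (q2 ^ 'n) set" where
  "qball c m = {x. vnorm (x - c) \<le> 2 powi m}"

lemma mem_qball: "x \<in> qball c m \<longleftrightarrow> (\<forall>\<nu>. q2_abs (x $ \<nu> - c $ \<nu>) \<le> 2 powi m)"
  by (simp add: qball_def vnorm_le_iff)

lemma centre_in_qball [simp]: "c \<in> qball c m"
  by (simp add: mem_qball)

lemma qball_mono: "m \<le> k \<Longrightarrow> qball c m \<subseteq> qball c k"
  unfolding qball_def using order_trans by fastforce

lemma qball_recentre:
  assumes "y \<in> qball c m"
  shows "qball y m = qball c m"
proof -
  have y: "q2_abs (y $ \<nu> - c $ \<nu>) \<le> 2 powi m" for \<nu> using assms by (simp add: mem_qball)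
  have "q2_abs (x $ \<nu> - y $ \<nu>) \<le> 2 powi m \<longleftrightarrow> q2_abs (x $ \<nu> - c $ \<nu>) \<le> 2 powi m" for x :: "q2 ^ 'a" and \<nu>
    using q2_abs_add_le[of "x $ \<nu> - y $ \<nu>" "2 powi m" "y $ \<nu> - c $ \<nu>"]
      q2_abs_diff_le[of "x $ \<nu> - c $ \<nu>" "2 powi m" "y $ \<nu> - c $ \<nu>"] y[of \<nu>] by auto
  then show ?thesis by (auto simp: mem_qball)
qed

lemma qball_translate: "(\<lambda>x. a + x) -` qball c m = qball (c - a) m"
  by (auto simp: mem_qball algebra_simps)

text \<open>A common point can serve as centre of both balls, so balls that meet are nested.\<close>

lemma qball_Int:
  assumes "m \<le> k"
  shows "qball c m \<inter> qball d k = qball c m \<or> qball c m \<inter> qball d k = {}"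
proof (cases "qball c m \<inter> qball d k = {}")
  case False
  then obtain y where y: "y \<in> qball c m" "y \<in> qball d k" by blast
  then have "qball c m \<subseteq> qball d k"
    using qball_recentre qball_mono[OF assms, of y] by metis
  then show ?thesis by blast
qed simp

text \<open>\<open>dist\<close> on vectors is Euclidean in the coordinate distances, whereas
  \<open>vnorm\<close> is their maximum; the comparison shows that the balls \<open>qball\<close>
  form a base of the topology.\<close>

lemma dist_le_of_qball:
  assumes "y \<in> qball x m"
  shows "dist y (x :: q2 ^ 'n::finite) \<le> real CARD('n) * 2 powi m"
proof -
  have "dist y x \<le> (\<Sum>i\<in>UNIV. dist (y $ i) (x $ i))"
    unfolding dist_vec_def by (rule L2_set_le_sum) simp
  also have "\<dots> \<le> (\<Sum>i\<in>(UNIV :: 'n set). 2 powi m)"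
    using assms by (intro sum_mono) (simp add: mem_qball dist_q2_def)
  finally show ?thesis by simp
qed

lemma qball_subset_ball:
  assumes "e > 0"
  obtains k :: nat where "\<And>x :: q2 ^ 'n::finite. qball x (- int k) \<subseteq> ball x e"
proof -
  obtain k where k: "(1 / 2) ^ k < e / real CARD('n)"
    using real_arch_pow_inv[of "e / real CARD('n)" "1 / 2"] assms by auto
  have p: "2 powi (- int k) = (1 / 2 :: real) ^ k"
    by (simp add: power_int_minus power_divide inverse_eq_divide)
  have "qball x (- int k) \<subseteq> ball x e" for x :: "q2 ^ 'n"
  proof
    fix y assume "y \<in> qball x (- int k)"
    then have "dist y x \<le> real CARD('n) * (1 / 2) ^ k"
      using dist_le_of_qball[of y x "- int k"] unfolding p by simp
    also have "\<dots> < e" using k by (simp add: field_simps)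
    finally show "y \<in> ball x e" by (simp add: dist_commute)
  qed
  then show ?thesis by (rule that)
qed

lemma open_qball: "open (qball c m)"
  unfolding open_dist
proof (intro ballI exI conjI allI impI)
  fix x y assume x: "x \<in> qball c m" and y: "dist y x < 2 powi m"
  have "q2_abs (y $ \<nu> - x $ \<nu>) \<le> 2 powi m" for \<nu>
    using dist_vec_nth_le[of y \<nu> x] y by (simp add: dist_q2_def)
  then have "y \<in> qball x m" by (simp add: mem_qball)
  then show "y \<in> qball c m" using qball_recentre[OF x] by simp
qed simp

lemma closed_qball: "closed (qball c m)"
  unfolding closed_def
proof (subst open_subopen, intro ballI)
  fix y assume y: "y \<in> - qball c m"
  have "x \<notin> qball c m" if "x \<in> qball y m" for x
    using that y by (metis ComplD centre_in_qball qball_recentre)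
  then show "\<exists>T. open T \<and> y \<in> T \<and> T \<subseteq> - qball c m"
    using open_qball[of y m] centre_in_qball[of y m] by blast
qed

lemma open_contains_qball:
  assumes "open U" "x \<in> U"
  obtains k :: nat where "qball x (- int k) \<subseteq> U"
  by (meson assms open_contains_ball qball_subset_ball order_trans)

lemma q2_abs_scale_le:
  "q2_abs (t - 2 powi (- m) * s) \<le> 2 powi (m + l) \<longleftrightarrow> q2_abs (2 powi m * t - s) \<le> 2 powi l"
proof -
  have "2 powi m * t - s = 2 powi m * (t - 2 powi (- m) * s)"
    by (simp add: algebra_simps power_int_minus)
  then have "q2_abs (2 powi m * t - s) = 2 powi (- m) * q2_abs (t - 2 powi (- m) * s)"
    by (simp add: q2_abs_mult q2_abs_2_powi)
  moreover have "(2::real) powi (m + l) = 2 powi m * 2 powi l"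
    by (simp add: power_int_add)
  moreover have "Q \<le> 2 powi m * P \<longleftrightarrow> 2 powi (- m) * Q \<le> P" for P Q :: real
    unfolding power_int_minus by (simp add: inverse_eq_divide pos_divide_le_eq mult.commute)
  ultimately show ?thesis by simp
qed

text \<open>The pieces are the classes of \<open>2 powi m * (x - c)\<close> modulo
  \<open>2 ^ k\<close>, one residue per coordinate. The covering gives total boundedness, and
  disjointness gives the scaling law of the measure.\<close>

lemma qball_split:
  fixes c :: "q2 ^ 'n::finite" and m :: int and k :: nat
  defines "B \<equiv> \<lambda>f. qball (c + (\<chi> \<nu>. 2 powi (- m) * of_nat (f \<nu>))) (m - int k)"
  defines "F \<equiv> (UNIV :: 'n set) \<rightarrow>\<^sub>E {..<2 ^ k}"
  shows "qball c m = (\<Union>f\<in>F. B f)" "disjoint_family_on B F"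
proof -
  have scale: "q2_abs (t - 2 powi (- m) * s) \<le> 2 powi (m - int k) \<longleftrightarrow> q2_abs (2 powi m * t - s) \<le> 2 powi (- int k)" for t s
    using q2_abs_scale_le[of t m s "- int k"] by simp
  show "qball c m = (\<Union>f\<in>F. B f)"
  proof (intro set_eqI iffI)
    fix x assume x: "x \<in> qball c m"
    have "\<exists>a::nat. a < 2 ^ k \<and> q2_abs (2 powi m * (x $ \<nu> - c $ \<nu>) - of_nat a) \<le> 2 powi (- int k)" for \<nu>
    proof -
      have "q2_abs (2 powi m * (x $ \<nu> - c $ \<nu>)) = 2 powi (- m) * q2_abs (x $ \<nu> - c $ \<nu>)"
        by (simp add: q2_abs_mult q2_abs_2_powi)
      also have "\<dots> \<le> 2 powi (- m) * 2 powi m"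
        using x by (intro mult_left_mono) (auto simp: mem_qball)
      also have "\<dots> = 1" by (simp flip: power_int_add)
      finally show ?thesis using q2_integer_mod_power by metis
    qed
    then obtain f where f: "\<And>\<nu>. f \<nu> < (2::nat) ^ k"
      "\<And>\<nu>. q2_abs (2 powi m * (x $ \<nu> - c $ \<nu>) - of_nat (f \<nu>)) \<le> 2 powi (- int k)" by metis
    then have "f \<in> F" "x \<in> B f"
      using scale by (auto simp: F_def B_def mem_qball diff_diff_eq[symmetric])
    then show "x \<in> (\<Union>f\<in>F. B f)" by blast
  next
    fix x assume "x \<in> (\<Union>f\<in>F. B f)"
    then obtain f where f: "x \<in> B f" by blast
    have "q2_abs (x $ \<nu> - c $ \<nu>) \<le> 2 powi m" for \<nu>
    proof -
      have "q2_abs (x $ \<nu> - c $ \<nu> - 2 powi (- m) * of_nat (f \<nu>)) \<le> 2 powi (m - int k)"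
        using f by (simp add: B_def mem_qball diff_diff_eq)
      also have "\<dots> \<le> 2 powi m" by simp
      finally have 1: "q2_abs (x $ \<nu> - c $ \<nu> - 2 powi (- m) * of_nat (f \<nu>)) \<le> 2 powi m" .
      have "q2_abs (2 powi (- m) * of_nat (f \<nu>)) \<le> 2 powi m * 1"
        unfolding q2_abs_mult q2_abs_2_powi using q2_abs_of_int_le_1[of "int (f \<nu>)"]
        by (intro mult_mono) auto
      then show ?thesis using q2_abs_add_le[OF 1, of "2 powi (- m) * of_nat (f \<nu>)"] by simp
    qed
    then show "x \<in> qball c m" by (simp add: mem_qball)
  qed
  show "disjoint_family_on B F"
    unfolding disjoint_family_on_def
  proof (intro ballI impI)
    fix f g assume fg: "f \<in> F" "g \<in> F" "f \<noteq> g"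
    show "B f \<inter> B g = {}"
    proof (rule ccontr)
      assume "B f \<inter> B g \<noteq> {}"
      then obtain x where x: "x \<in> B f" "x \<in> B g" by blast
      have "f \<nu> = g \<nu>" for \<nu>
      proof (rule q2_integer_mod_power_unique[of _ k])
        show "f \<nu> < 2 ^ k" "g \<nu> < 2 ^ k" using fg by (auto simp: F_def)
        have "q2_abs (2 powi m * (x $ \<nu> - c $ \<nu>) - of_nat (f \<nu>)) \<le> 2 powi (- int k)"
          "q2_abs (2 powi m * (x $ \<nu> - c $ \<nu>) - of_nat (g \<nu>)) \<le> 2 powi (- int k)"
          unfolding scale[symmetric] using x by (simp_all add: B_def mem_qball diff_diff_eq)
        from q2_abs_diff_le[OF this(2) this(1)]
        show "q2_abs (of_nat (f \<nu>) - of_nat (g \<nu>)) \<le> 2 powi (- int k)" by simp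
      qed
      then show False using fg(3) by auto
    qed
  qed
qed

lemma compact_qball: "compact (qball (c :: q2 ^ 'n::finite) m)"
  unfolding compact_eq_totally_bounded
proof (intro conjI allI impI)
  show "complete (qball c m)" using closed_qball by (simp add: complete_eq_closed)
  fix e :: real assume "e > 0"
  then obtain k :: nat where k: "\<And>x :: q2 ^ 'n. qball x (- int k) \<subseteq> ball x e"
    using qball_subset_ball by blast
  \<comment> \<open>Ensures \<open>m - int l \<le> - int k\<close>, also when
    \<open>m + int k\<close> is negative and \<open>nat\<close> returns 0.\<close>
  define l where "l = nat (m + int k)"
  define K where "K = (\<lambda>f. c + (\<chi> \<nu>. 2 powi (- m) * of_nat (f \<nu>))) ` ((UNIV :: 'n set) \<rightarrow>\<^sub>E {..<2 ^ l})"
  have "qball x (m - int l) \<subseteq> ball x e" for x :: "q2 ^ 'n"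
    by (rule order_trans[OF qball_mono k]) (simp add: l_def)
  then have "qball c m \<subseteq> (\<Union>x\<in>K. ball x e)"
    unfolding qball_split(1)[of c m l] K_def by blast
  moreover have "finite K" unfolding K_def by (intro finite_imageI finite_PiE) auto
  ultimately show "\<exists>K. finite K \<and> qball c m \<subseteq> (\<Union>x\<in>K. ball x e)" by blast
qed

section \<open>Balls as generators of the Borel sets\<close>

definition qballs :: "(q2 ^ 'n::finite) set set" where
  "qballs = insert {} (range (\<lambda>(c, k :: nat). qball c (- int k)))"

definition rat_qballs :: "(q2 ^ 'n::finite) set set" where
  "rat_qballs = range (\<lambda>(g :: rat ^ 'n, k :: nat). qball (\<chi> \<nu>. of_rat (g $ \<nu>)) (- int k))"

lemma countable_rat_qballs: "countable rat_qballs"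
  unfolding rat_qballs_def by simp

lemma rat_qballs_subset: "rat_qballs \<subseteq> qballs"
  unfolding rat_qballs_def qballs_def by auto

text \<open>Every point of a ball is a centre, and rational points are dense; hence there are only
  countably many balls of these radii.\<close>

lemma qball_in_rat_qballs: "qball c (- int k) \<in> rat_qballs"
proof -
  have "\<exists>q. q2_abs (c $ \<nu> - of_rat q) < 2 powi (- int k)" for \<nu>
    by (metis q2_rat_dense zero_less_power_int zero_less_numeral)
  then obtain g where g: "\<And>\<nu>. q2_abs (c $ \<nu> - of_rat (g \<nu>)) < 2 powi (- int k)" by metis
  have "c \<in> qball (\<chi> \<nu>. of_rat ((\<chi> i. g i) $ \<nu>)) (- int k)"
    using g by (simp add: mem_qball less_imp_le)
  then have "qball c (- int k) = qball (\<chi> \<nu>. of_rat ((\<chi> i. g i) $ \<nu>)) (- int k)"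
    by (rule qball_recentre)
  then show ?thesis unfolding rat_qballs_def
    by (intro range_eqI[of _ _ "(\<chi> i. g i, k)"]) (simp only: prod.case)
qed

text \<open>Two balls are nested or disjoint; the disjoint case is why \<open>qballs\<close>
  contains the empty set.\<close>

lemma Int_stable_qballs: "Int_stable qballs"
proof (rule Int_stableI)
  fix A B :: "(q2 ^ 'n) set" assume AB: "A \<in> qballs" "B \<in> qballs"
  show "A \<inter> B \<in> qballs"
  proof (cases "A = {} \<or> B = {}")
    case False
    then obtain c k d l where A: "A = qball c (- int k)" and B: "B = qball d (- int l)"
      using AB by (auto simp: qballs_def)
    have "A \<inter> B = A \<or> A \<inter> B = B \<or> A \<inter> B = {}"
    proof (cases "l \<le> k")
      case True
      then show ?thesis unfolding A B using qball_Int[of "- int k" "- int l" c d] by auto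
    next
      case False
      then show ?thesis unfolding A B using qball_Int[of "- int l" "- int k" d c] by auto
    qed
    then show ?thesis using AB by (auto simp: qballs_def)
  qed (auto simp: qballs_def)
qed

lemma sets_borel_qballs: "sets (borel :: (q2 ^ 'n::finite) measure) = sigma_sets UNIV qballs"
proof -
  have "sigma_sets UNIV {S :: (q2 ^ 'n) set. open S} = sigma_sets UNIV qballs"
  proof (rule sigma_sets_eqI)
    fix U :: "(q2 ^ 'n) set" assume "U \<in> {S. open S}"
    then have U: "open U" by simp
    \<comment> \<open>Rational centres keep this union countable.\<close>
    have "U = \<Union>{B \<in> rat_qballs. B \<subseteq> U}"
    proof (intro set_eqI iffI)
      fix x assume "x \<in> U"
      then obtain k :: nat where "qball x (- int k) \<subseteq> U" using open_contains_qball[OF U] by blast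
      then show "x \<in> \<Union>{B \<in> rat_qballs. B \<subseteq> U}"
        using qball_in_rat_qballs[of x k] centre_in_qball[of x "- int k"] by blast
    qed blast
    moreover have "\<Union>{B \<in> rat_qballs. B \<subseteq> U} \<in> sigma_sets UNIV qballs"
      by (rule sigma_sets_UNION)
        (use countable_rat_qballs rat_qballs_subset in \<open>auto intro: countable_subset[of _ rat_qballs]\<close>)
    ultimately show "U \<in> sigma_sets UNIV qballs" by simp
  next
    fix B :: "(q2 ^ 'n) set" assume "B \<in> qballs"
    then have "open B" by (auto simp: qballs_def open_qball)
    then show "B \<in> sigma_sets UNIV {S. open S}" by blast
  qed
  then show ?thesis unfolding borel_def by simp
qed

lemma measurable_translation [measurable]: "(\<lambda>x. a + x) \<in> borel \<rightarrow>\<^sub>M (borel :: (q2 ^ 'n::finite) measure)"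
proof (rule measurable_sigma_sets[OF sets_borel_qballs])
  fix A :: "(q2 ^ 'n) set" assume "A \<in> qballs"
  then have "A = {} \<or> (\<exists>c k. A = qball c (- int k))" by (auto simp: qballs_def)
  then show "(\<lambda>x. a + x) -` A \<inter> space borel \<in> sets borel"
    by (auto simp: qball_translate open_qball)
qed auto

text \<open>Uniqueness on an intersection-stable generator, with a countable cover by balls of
  finite measure. It serves twice: for the uniqueness of the Haar measure and for the translation
  invariance of the constructed one.\<close>

lemma measure_eq_of_qballs:
  fixes M N :: "(q2 ^ 'n::finite) measure"
  assumes "sets M = sets borel" "sets N = sets borel"
    and "\<And>c k. emeasure M (qball c (- int k)) = emeasure N (qball c (- int k))"
    and "\<And>c k. emeasure M (qball c (- int k)) \<noteq> \<infinity>"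
  shows "M = N"
proof (rule measure_eqI_generator_eq_countable[of qballs UNIV M N rat_qballs])
  show "\<Union> rat_qballs = (UNIV :: (q2 ^ 'n) set)"
    using qball_in_rat_qballs centre_in_qball by blast
  show "emeasure M X = emeasure N X" if "X \<in> qballs" for X
    using that assms(3) by (auto simp: qballs_def)
  show "emeasure M X \<noteq> \<infinity>" if "X \<in> rat_qballs" for X
    using that assms(4) by (auto simp: rat_qballs_def)
qed (use assms(1,2) in \<open>simp_all add: Int_stable_qballs sets_borel_qballs rat_qballs_subset countable_rat_qballs\<close>)

definition invariant_normalized :: "(q2 ^ 'n::finite) measure \<Rightarrow> bool" where
  "invariant_normalized M \<longleftrightarrow> sets M = sets borel \<and>
     (\<forall>a. distr M borel (\<lambda>x. a + x) = M) \<and> emeasure M {x. vnorm x \<le> 1} = 1"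

text \<open>Balls of equal radius are translates of each other, and a ball splits into
  \<open>(2 ^ k) ^ CARD('n)\<close> balls whose radius is smaller by the factor
  \<open>2 ^ k\<close>; so the unit ball determines all other values.\<close>

lemma emeasure_qball_invariant:
  fixes M :: "(q2 ^ 'n::finite) measure"
  assumes "invariant_normalized M"
  shows "emeasure M (qball c m) = ennreal ((2 powi m) ^ CARD('n))"
proof -
  have sM: "sets M = sets borel" and inv: "\<And>a. distr M borel (\<lambda>x. a + x) = M"
    and u: "emeasure M {x. vnorm x \<le> 1} = 1"
    using assms by (auto simp: invariant_normalized_def)
  have spM: "space M = UNIV" using sets_eq_imp_space_eq[OF sM] by simp
  have meas: "(\<lambda>x. a + x) \<in> measurable M borel" for a
    using measurable_translation measurable_cong_sets[OF sM refl] by blast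
  have tr: "emeasure M (qball c m) = emeasure M (qball 0 m)" for c m
  proof -
    have "emeasure M (qball 0 m) = emeasure (distr M borel (\<lambda>x. (- c) + x)) (qball 0 m)"
      by (simp only: inv)
    also have "\<dots> = emeasure M ((\<lambda>x. (- c) + x) -` qball 0 m \<inter> space M)"
      by (rule emeasure_distr[OF meas]) (simp add: open_qball)
    finally show ?thesis unfolding qball_translate by (simp add: spM)
  qed
  have split: "emeasure M (qball 0 m) = (2 ^ k) ^ CARD('n) * emeasure M (qball 0 (m - int k))" for m k
  proof -
    let ?B = "\<lambda>f. qball (0 + (\<chi> \<nu>. 2 powi (- m) * of_nat (f \<nu>))) (m - int k) :: (q2 ^ 'n) set"
    let ?F = "(UNIV :: 'n set) \<rightarrow>\<^sub>E {..<2 ^ k :: nat}"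
    have fin: "finite ?F" by (intro finite_PiE) auto
    have "emeasure M (qball 0 m) = emeasure M (\<Union>f\<in>?F. ?B f)"
      by (simp only: qball_split(1)[of 0 m k])
    also have "\<dots> = (\<Sum>f\<in>?F. emeasure M (?B f))"
      using qball_split(2)[of 0 m k] fin
      by (intro sum_emeasure[symmetric]) (auto simp: sM open_qball)
    also have "\<dots> = (\<Sum>f\<in>?F. emeasure M (qball 0 (m - int k)))"
      by (intro sum.cong refl tr)
    also have "\<dots> = of_nat (card ?F) * emeasure M (qball 0 (m - int k))"
      by simp
    also have "card ?F = (2 ^ k) ^ CARD('n)" by (simp add: card_PiE)
    finally show ?thesis by simp
  qed
  have u0: "emeasure M (qball 0 0) = 1" using u by (simp add: qball_def)
  have "emeasure M (qball 0 m) = ennreal ((2 powi m) ^ CARD('n))"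
  proof (cases "m \<ge> 0")
    case True
    then obtain k where k: "m = int k" using nonneg_int_cases by blast
    have "emeasure M (qball 0 m) = ennreal (2 ^ k) ^ CARD('n)"
      using split[of "int k" k] u0 k ennreal_power[of 2 k] by simp
    also have "\<dots> = ennreal ((2 ^ k) ^ CARD('n))" by (rule ennreal_power) simp
    finally show ?thesis by (simp add: k)
  next
    case False
    then obtain k where k: "m = - int k" using nonpos_int_cases[of m] by (metis linear)
    \<comment> \<open>Here the unit ball is the one that is split; in \<open>ennreal\<close> the
      finite factor is cancelled by multiplying with its inverse.\<close>
    have "1 = ennreal ((2 ^ k) ^ CARD('n)) * emeasure M (qball 0 (- int k))"
      using split[of 0 k] u0 by (simp flip: ennreal_power)
    then have "ennreal (inverse ((2 ^ k) ^ CARD('n))) * 1 = ennreal (inverse ((2 ^ k) ^ CARD('n))) * (ennreal ((2 ^ k) ^ CARD('n)) * emeasure M (qball 0 (- int k)))"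
      by simp
    also have "\<dots> = emeasure M (qball 0 (- int k))"
      by (simp flip: mult.assoc ennreal_mult del: ennreal_power)
    finally show ?thesis unfolding k power_int_minus by (simp add: power_inverse)
  qed
  then show ?thesis using tr[of c m] by simp
qed

section \<open>Existence of the Haar measure\<close>

definition dyadic :: "rat set" where
  "dyadic = {r. (\<exists>m k :: nat. r = of_nat m / 2 ^ k) \<and> r < 1}"

text \<open>The denominator of the difference is a power of 2, and integrality at 2 cancels exactly
  that. Neither fraction has to lie below 1, which the additivity of \<open>frac2\<close> modulo
  integers relies on.\<close>

lemma dyadic_diff_integral:
  fixes m m' k k' :: nat
  assumes "q2_abs (of_rat (of_nat m / 2 ^ k - of_nat m' / 2 ^ k')) \<le> 1"
  shows "of_nat m / 2 ^ k - of_nat m' / 2 ^ k' \<in> (\<int> :: rat set)"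
proof -
  let ?d = "of_nat m / 2 ^ k - of_nat m' / 2 ^ k' :: rat"
  define M where "M = int m * 2 ^ k' - int m' * 2 ^ k"
  have M: "of_int M = 2 ^ (k + k') * ?d"
    by (simp add: M_def field_simps power_add)
  have "(1 / 2) ^ (k + k') * rat_abs2 ?d \<le> (1 / 2) ^ (k + k')"
    using assms by (simp add: q2_abs_of_rat mult_left_le)
  moreover have "rat_abs2 (of_int M) = (1 / 2) ^ (k + k') * rat_abs2 ?d"
    unfolding M using q2_abs_of_rat[of "2 ^ (k + k')"]
    by (simp add: of_rat_power q2_abs_power q2_abs_2)
  moreover have "(1 / 2 :: real) ^ (k + k') = 2 powi (- int (k + k'))"
    unfolding power_int_minus power_int_of_nat by (simp add: power_divide inverse_eq_divide)
  ultimately have "2 ^ (k + k') dvd M" using rat_abs2_of_int_le_iff by metis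
  then obtain q where "M = 2 ^ (k + k') * q" by blast
  then have "?d = of_int q" using M by simp
  then show ?thesis by (metis Ints_of_int)
qed

lemma dyadic_unique:
  assumes "r \<in> dyadic" "r' \<in> dyadic" "q2_abs (t - of_rat r) \<le> 1" "q2_abs (t - of_rat r') \<le> 1"
  shows "r = r'"
proof -
  have "q2_abs (of_rat (r' - r)) \<le> 1"
    using q2_abs_diff_le[OF assms(3,4)] by (simp add: of_rat_diff)
  moreover obtain m k m' k' where r: "r = of_nat m / 2 ^ k" "r' = of_nat m' / 2 ^ k'" and lt: "r < 1" "r' < 1"
    using assms(1,2) by (auto simp: dyadic_def)
  ultimately have "r' - r \<in> \<int>" using dyadic_diff_integral[of m' k' m k] by simp
  then obtain z where z: "r' - r = of_int z" by (auto elim: Ints_cases)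
  have "0 \<le> r" "0 \<le> r'" using r by simp_all
  then have "(of_int z :: rat) < of_int 1" "of_int (- 1) < (of_int z :: rat)" using z lt by linarith+
  then have "z < 1" "- 1 < z" unfolding of_int_less_iff .
  then show ?thesis using z by simp
qed

lemma dyadic_exists: "\<exists>r\<in>dyadic. q2_abs (t - of_rat r) \<le> 1"
proof -
  \<comment> \<open>One \<open>k\<close> serves twice: it makes \<open>2 ^ k * t\<close> integral,
    and reduction modulo \<open>2 ^ k\<close> brings the quotient below 1.\<close>
  obtain k :: nat where k: "q2_abs t \<le> 2 ^ k"
    using real_arch_pow[of 2 "q2_abs t"] by (auto intro: less_imp_le)
  then have "q2_abs (2 ^ k * t) \<le> 1"
    by (simp add: q2_abs_mult q2_abs_power q2_abs_2 power_divide field_simps)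
  then obtain m :: nat where m: "m < 2 ^ k" "q2_abs (2 ^ k * t - of_nat m) \<le> 2 powi (- int k)"
    by (rule q2_integer_mod_power)
  define r :: rat where "r = of_nat m / 2 ^ k"
  have "2 ^ k * t - of_nat m = 2 ^ k * (t - of_rat r)"
    by (simp add: r_def of_rat_divide of_rat_power field_simps)
  then have "(1 / 2) ^ k * q2_abs (t - of_rat r) \<le> 2 powi (- int k)"
    using m(2) by (simp add: q2_abs_mult q2_abs_power q2_abs_2)
  then have "q2_abs (t - of_rat r) \<le> 1"
    by (simp add: power_int_minus power_divide field_simps)
  moreover have "r \<in> dyadic"
  proof -
    have "rat_of_nat m < rat_of_nat (2 ^ k)" using m(1) by (simp only: of_nat_less_iff)
    then show ?thesis by (auto simp: dyadic_def r_def field_simps)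
  qed
  ultimately show ?thesis by blast
qed

text \<open>Makes \<open>from_nat_into dyadic\<close> a bijection from the natural numbers, so that
  the integer part of a real number can enumerate the cosets.\<close>

lemma infinite_dyadic: "infinite dyadic"
proof -
  have "inj (\<lambda>k :: nat. 1 / 2 ^ Suc k :: rat)"
    by (rule injI) simp
  moreover have "range (\<lambda>k :: nat. 1 / 2 ^ Suc k :: rat) \<subseteq> dyadic"
  proof safe
    fix k
    have "(1 :: rat) < 2 ^ Suc k" by (rule one_less_power) auto
    then have "1 / 2 ^ Suc k < (1 :: rat)" by (subst divide_less_eq_1_pos) auto
    moreover have "1 / 2 ^ Suc k = (of_nat 1 / 2 ^ Suc k :: rat)" by simp
    ultimately show "1 / 2 ^ Suc k \<in> dyadic"
      unfolding dyadic_def by blast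
  qed
  ultimately show ?thesis using infinite_super range_inj_infinite by blast
qed

section \<open>Digit reversal, from binary fractions to 2-adic integers\<close>

primrec digit_reverse :: "nat \<Rightarrow> int \<Rightarrow> int" where
  "digit_reverse 0 N = 0"
| "digit_reverse (Suc k) N = digit_reverse k (N div 2) + (N mod 2) * 2 ^ k"

text \<open>Reversal permutes the residues modulo \<open>2 ^ k\<close>. In the induction, the
  residue of \<open>c\<close> modulo \<open>2 ^ k\<close> determines \<open>N div 2\<close>, and the
  next 2-adic digit of \<open>c\<close> determines the last bit of \<open>N\<close>.\<close>

lemma digit_reverse_residue:
  assumes "q2_abs c \<le> 1"
  shows "\<exists>j\<in>{0..<2 ^ k}. \<forall>N\<in>{0..<2 ^ k}. q2_abs (of_int (digit_reverse k N) - c) \<le> 2 powi (- int k) \<longleftrightarrow> N = j"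
proof (induction k)
  case 0
  show ?case using assms by (intro bexI[of _ 0]) auto
next
  case (Suc k)
  then obtain j where j: "0 \<le> j" "j < 2 ^ k"
    "\<And>N. 0 \<le> N \<Longrightarrow> N < 2 ^ k \<Longrightarrow> q2_abs (of_int (digit_reverse k N) - c) \<le> 2 powi (- int k) \<longleftrightarrow> N = j"
    by auto
  define d where "d = digit_reverse k j"
  have "q2_abs (of_int d - c) \<le> 2 powi (- int k)" using j by (simp add: d_def)
  then have "q2_abs ((c - of_int d) / 2 ^ k) \<le> 1"
    by (simp add: q2_abs_divide q2_abs_power q2_abs_2 power_divide power_int_minus field_simps
        q2_abs_minus_commute[of c])
  then obtain b :: nat where b: "b < 2" "q2_abs ((c - of_int d) / 2 ^ k - of_nat b) \<le> 1 / 2"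
    by (rule q2_residue_field)
  have "c - of_int (d + int b * 2 ^ k) = 2 ^ k * ((c - of_int d) / 2 ^ k - of_nat b)"
    by (simp add: field_simps)
  then have "q2_abs (c - of_int (d + int b * 2 ^ k)) = (1 / 2) ^ k * q2_abs ((c - of_int d) / 2 ^ k - of_nat b)"
    by (simp add: q2_abs_mult q2_abs_power q2_abs_2)
  also have "\<dots> \<le> (1 / 2) ^ k * (1 / 2)" using b(2) by (intro mult_left_mono) auto
  also have "\<dots> = 2 powi (- int (Suc k))"
    unfolding power_int_minus power_int_of_nat by (simp add: power_divide inverse_eq_divide)
  finally have cb: "q2_abs (of_int (d + int b * 2 ^ k) - c) \<le> 2 powi (- int (Suc k))"
    by (simp only: q2_abs_minus_commute)
  have "q2_abs (of_int (digit_reverse (Suc k) N) - c) \<le> 2 powi (- int (Suc k)) \<longleftrightarrow> N = 2 * j + int b"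
    if N: "0 \<le> N" "N < 2 ^ Suc k" for N
  proof
    assume "N = 2 * j + int b"
    then have "N div 2 = j" "N mod 2 = int b" using b(1) by auto
    then show "q2_abs (of_int (digit_reverse (Suc k) N) - c) \<le> 2 powi (- int (Suc k))"
      using cb by (simp add: d_def)
  next
    assume h: "q2_abs (of_int (digit_reverse (Suc k) N) - c) \<le> 2 powi (- int (Suc k))"
    have le: "2 powi (- int (Suc k)) \<le> (2 powi (- int k) :: real)"
      unfolding power_int_le_iff_real by simp
    have "q2_abs (of_int (N mod 2 * 2 ^ k)) \<le> 2 powi (- int k)"
      unfolding q2_abs_of_int_le_iff by simp
    from q2_abs_diff_le[OF order_trans[OF h le] this]
    have "q2_abs (of_int (digit_reverse k (N div 2)) - c) \<le> 2 powi (- int k)"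
      by (simp add: algebra_simps)
    then have Nj: "N div 2 = j" using j(3)[of "N div 2"] N by auto
    have "q2_abs (of_int (N mod 2 * 2 ^ k - int b * 2 ^ k)) \<le> 2 powi (- int (Suc k))"
      using q2_abs_diff_le[OF h cb] by (simp add: Nj d_def)
    then have "2 ^ Suc k dvd N mod 2 * 2 ^ k - int b * 2 ^ k"
      unfolding q2_abs_of_int_le_iff .
    then have "2 ^ k * 2 dvd 2 ^ k * (N mod 2 - int b)" by (simp add: algebra_simps)
    then have "2 dvd N mod 2 - int b" by (subst (asm) dvd_mult_cancel_left) simp
    then have "N mod 2 = int b" using b(1) by presburger
    then show "N = 2 * j + int b" using Nj mult_div_mod_eq[of 2 N] by simp
  qed
  moreover have "2 * j + int b \<in> {0..<2 ^ Suc k}" using j(1,2) b(1) by auto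
  ultimately show ?case by (intro bexI[of _ "2 * j + int b"]) auto
qed

text \<open>Partial sums of the 2-adic number whose digit at \<open>2 ^ i\<close> is the binary
  digit of \<open>t\<close> with weight \<open>1 / 2 ^ (i + 1)\<close>, for t in [0,1). The reversal
  makes a further binary digit of \<open>t\<close> a 2-adically small correction.\<close>

definition digits2 :: "real \<Rightarrow> nat \<Rightarrow> rat" where
  "digits2 t k = of_int (digit_reverse k \<lfloor>2 ^ k * t\<rfloor>)"

lemma floor_double_div: "\<lfloor>2 * t :: real\<rfloor> div 2 = \<lfloor>t\<rfloor>"
  by linarith

lemma digits2_diff:
  assumes "k \<le> n"
  shows "rat_abs2 (digits2 t n - digits2 t k) \<le> 2 powi (- int k)"
  using assms
proof (induction n rule: dec_induct)
  case (step n)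
  have "digits2 t (Suc n) - digits2 t n = of_int (\<lfloor>2 * (2 ^ n * t)\<rfloor> mod 2 * 2 ^ n)"
    by (simp add: digits2_def floor_double_div mult.assoc)
  moreover have "2 ^ k dvd \<lfloor>2 * (2 ^ n * t)\<rfloor> mod 2 * 2 ^ n"
    using step(1) by (intro dvd_mult le_imp_power_dvd)
  ultimately have "rat_abs2 (digits2 t (Suc n) - digits2 t n) \<le> 2 powi (- int k)"
    by (simp only: rat_abs2_of_int_le_iff)
  then show ?case
    using step.IH rat_abs2_add_le_max[of "digits2 t (Suc n) - digits2 t n" "digits2 t n - digits2 t k"] by simp
qed simp

lemma cauchy2_digits2: "cauchy2 (digits2 t)"
  unfolding cauchy2_def
proof (intro allI impI)
  fix e :: real assume "e > 0"
  then obtain k where "(1 / 2) ^ k < e" using real_arch_pow_inv[of e "1 / 2"] by auto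
  moreover have "2 powi (- int k) = (1 / 2 :: real) ^ k"
    by (simp add: power_int_minus power_divide inverse_eq_divide)
  ultimately have k: "2 powi (- int k) < e" by simp
  have "rat_abs2 (digits2 t m - digits2 t n) < e" if "k \<le> m" "k \<le> n" for m n
    using digits2_diff[OF that(1), of t] digits2_diff[OF that(2), of t] k
      rat_abs2_add_le_max[of "digits2 t m - digits2 t k" "digits2 t k - digits2 t n"]
      rat_abs2_minus_commute[of "digits2 t k" "digits2 t n"] by simp
  then show "\<exists>N. \<forall>m\<ge>N. \<forall>n\<ge>N. rat_abs2 (digits2 t m - digits2 t n) < e" by blast
qed

lemma abs_q2_digits2: "q2_abs (abs_q2 (digits2 t) - of_rat (digits2 t k)) \<le> 2 powi (- int k)"
proof -
  obtain n where n: "n \<ge> k" "q2_abs (abs_q2 (digits2 t) - of_rat (digits2 t n)) < 2 powi (- int k)"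
  proof -
    obtain N where "\<forall>n\<ge>N. q2_abs (abs_q2 (digits2 t) - of_rat (digits2 t n)) < 2 powi (- int k)"
      using abs_q2_limit[OF cauchy2_digits2, of "2 powi (- int k)" t] by auto
    then have "q2_abs (abs_q2 (digits2 t) - of_rat (digits2 t (max k N))) < 2 powi (- int k)"
      by (meson max.cobounded2)
    then show ?thesis using that max.cobounded1 by blast
  qed
  have "q2_abs (of_rat (digits2 t n) - of_rat (digits2 t k)) \<le> 2 powi (- int k)"
    using digits2_diff[OF n(1), of t] by (simp flip: of_rat_diff add: q2_abs_of_rat)
  from q2_abs_add_le[OF less_imp_le[OF n(2)] this] show ?thesis by simp
qed

text \<open>Up to an error of \<open>2 powi (- int k)\<close>, which the ultrametric inequality
  absorbs, the limit is its partial sum number \<open>k\<close>, and that depends only on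
  \<open>\<lfloor>2 ^ k * t\<rfloor>\<close>.\<close>

lemma digits2_interval:
  assumes "q2_abs c \<le> 1"
  obtains j where "0 \<le> j" "j < 2 ^ k"
    "\<And>t. 0 \<le> t \<Longrightarrow> t < 1 \<Longrightarrow> q2_abs (abs_q2 (digits2 t) - c) \<le> 2 powi (- int k) \<longleftrightarrow> \<lfloor>2 ^ k * t\<rfloor> = j"
proof -
  obtain j where j0: "0 \<le> j" "j < 2 ^ k"
    and j: "\<And>N. 0 \<le> N \<Longrightarrow> N < 2 ^ k \<Longrightarrow> q2_abs (of_int (digit_reverse k N) - c) \<le> 2 powi (- int k) \<longleftrightarrow> N = j"
    using digit_reverse_residue[OF assms, of k] by auto
  have "q2_abs (abs_q2 (digits2 t) - c) \<le> 2 powi (- int k) \<longleftrightarrow> \<lfloor>2 ^ k * t\<rfloor> = j" if "0 \<le> t" "t < 1" for t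
  proof -
    have "q2_abs (abs_q2 (digits2 t) - c) \<le> 2 powi (- int k) \<longleftrightarrow> q2_abs (of_rat (digits2 t k) - c) \<le> 2 powi (- int k)"
      using q2_abs_add_le[of "of_rat (digits2 t k) - c" "2 powi (- int k)" "abs_q2 (digits2 t) - of_rat (digits2 t k)"]
        q2_abs_diff_le[of "abs_q2 (digits2 t) - c" "2 powi (- int k)" "abs_q2 (digits2 t) - of_rat (digits2 t k)"]
        abs_q2_digits2[of t k] by auto
    also have "\<dots> \<longleftrightarrow> \<lfloor>2 ^ k * t\<rfloor> = j"
      using that j[of "\<lfloor>2 ^ k * t\<rfloor>"] by (simp add: digits2_def floor_less_iff)
    finally show ?thesis .
  qed
  then show ?thesis using that j0 by blast
qed

text \<open>The integer part selects a coset of the 2-adic integers, the fractional part an element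
  of it. Bijectivity is not at stake: only the preimages of balls matter.\<close>

definition real_to_q2 :: "real \<Rightarrow> q2" where
  "real_to_q2 x = of_rat (from_nat_into dyadic (int_encode \<lfloor>x\<rfloor>)) + abs_q2 (digits2 (frac x))"

lemma real_to_q2_interval:
  obtains u where "\<And>x. q2_abs (real_to_q2 x - c) \<le> 2 powi (- int k) \<longleftrightarrow> u \<le> x \<and> x < u + 1 / 2 ^ k"
proof -
  have bij: "bij_betw (from_nat_into dyadic) UNIV dyadic"
    by (rule bij_betw_from_nat_into[OF _ infinite_dyadic]) simp
  obtain r where r: "r \<in> dyadic" "q2_abs (c - of_rat r) \<le> 1" using dyadic_exists by blast
  obtain n where n: "from_nat_into dyadic n = r"
    using r(1) bij by (metis bij_betw_imp_surj_on imageE)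
  define z where "z = int_decode n"
  obtain j where j0: "0 \<le> j" "j < 2 ^ k" and j: "\<And>t. 0 \<le> t \<Longrightarrow> t < 1 \<Longrightarrow>
      q2_abs (abs_q2 (digits2 t) - (c - of_rat r)) \<le> 2 powi (- int k) \<longleftrightarrow> \<lfloor>2 ^ k * t\<rfloor> = j"
    using digits2_interval[OF r(2)] by blast
  \<comment> \<open>Keeps the interval within the unit interval that starts at \<open>z\<close>, so
    that the converse direction can recover the integer part.\<close>
  have j1: "real_of_int j + 1 \<le> 2 ^ k"
  proof -
    have "j + 1 \<le> 2 ^ k" using j0 by simp
    then have "real_of_int (j + 1) \<le> real_of_int (2 ^ k)" by (simp only: of_int_le_iff)
    then show ?thesis by simp
  qed
  have "q2_abs (real_to_q2 x - c) \<le> 2 powi (- int k) \<longleftrightarrow> of_int z + of_int j / 2 ^ k \<le> x \<and> x < of_int z + of_int j / 2 ^ k + 1 / 2 ^ k" for x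
  proof -
    have "\<lfloor>x\<rfloor> = z" if h: "q2_abs (real_to_q2 x - c) \<le> 2 powi (- int k)"
    proof -
      let ?r = "from_nat_into dyadic (int_encode \<lfloor>x\<rfloor>)"
      \<comment> \<open>A ball of radius at most 1 lies in a single coset, which fixes the dyadic
        representative and with it the integer part.\<close>
      have "q2_abs (real_to_q2 x - c) \<le> 1"
        using h by (rule order_trans) (use power_int_le_iff_real[of "- int k" 0] in simp)
      moreover have "q2_abs (abs_q2 (digits2 (frac x))) \<le> 1"
        using abs_q2_digits2[of "frac x" 0] by (simp add: digits2_def)
      ultimately have "q2_abs ((real_to_q2 x - c) - abs_q2 (digits2 (frac x))) \<le> 1"
        by (rule q2_abs_diff_le)
      then have "q2_abs (c - of_rat ?r) \<le> 1"
        by (simp add: real_to_q2_def q2_abs_minus_commute[of c])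
      moreover have "?r \<in> dyadic" using bij by (auto simp: bij_betw_def)
      ultimately have "?r = r" using dyadic_unique r by blast
      then have "int_encode \<lfloor>x\<rfloor> = n" using bij n by (metis bij_betw_imp_inj_on injD)
      then show ?thesis by (auto simp: z_def)
    qed
    moreover have "q2_abs (real_to_q2 x - c) \<le> 2 powi (- int k) \<longleftrightarrow> \<lfloor>2 ^ k * frac x\<rfloor> = j" if "\<lfloor>x\<rfloor> = z"
    proof -
      have e: "real_to_q2 x - c = abs_q2 (digits2 (frac x)) - (c - of_rat r)"
        using that by (simp add: real_to_q2_def z_def n)
      show ?thesis unfolding e by (rule j) (simp_all add: frac_lt_1)
    qed
    ultimately have "q2_abs (real_to_q2 x - c) \<le> 2 powi (- int k) \<longleftrightarrow> \<lfloor>x\<rfloor> = z \<and> \<lfloor>2 ^ k * frac x\<rfloor> = j"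
      by blast
    also have "\<dots> \<longleftrightarrow> of_int z + of_int j / 2 ^ k \<le> x \<and> x < of_int z + of_int j / 2 ^ k + 1 / 2 ^ k"
    proof
      assume h: "\<lfloor>x\<rfloor> = z \<and> \<lfloor>2 ^ k * frac x\<rfloor> = j"
      then have "\<lfloor>2 ^ k * (x - of_int z)\<rfloor> = j" unfolding frac_def by auto
      then have "of_int j \<le> 2 ^ k * (x - of_int z)" "2 ^ k * (x - of_int z) < of_int j + 1"
        unfolding floor_eq_iff by simp_all
      then show "of_int z + of_int j / 2 ^ k \<le> x \<and> x < of_int z + of_int j / 2 ^ k + 1 / 2 ^ k"
        by (simp add: field_simps)
    next
      assume h: "of_int z + of_int j / 2 ^ k \<le> x \<and> x < of_int z + of_int j / 2 ^ k + 1 / 2 ^ k"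
      then have "of_int j \<le> 2 ^ k * (x - of_int z)" "2 ^ k * (x - of_int z) < of_int j + 1"
        by (simp_all add: field_simps)
      moreover have "0 \<le> of_int j / (2 ^ k :: real)" "of_int j / 2 ^ k + 1 / 2 ^ k \<le> (1 :: real)"
        using j0(1) j1 by (simp_all flip: add_divide_distrib)
      then have "of_int z \<le> x" "x < of_int z + 1" using h by linarith+
      then have "\<lfloor>x\<rfloor> = z" by linarith
      ultimately show "\<lfloor>x\<rfloor> = z \<and> \<lfloor>2 ^ k * frac x\<rfloor> = j" by (simp add: frac_def floor_eq_iff[of _ j])
    qed
    finally show ?thesis .
  qed
  then show ?thesis by (rule that)
qed

section \<open>Transport of Lebesgue measure\<close>

definition real_vec_to_q2 :: "real ^ 'n::finite \<Rightarrow> q2 ^ 'n" where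
  "real_vec_to_q2 x = (\<chi> \<nu>. real_to_q2 (x $ \<nu>))"

lemma real_vec_to_q2_box:
  fixes c :: "q2 ^ 'n::finite"
  obtains u where "real_vec_to_q2 -` qball c (- int k) = {x. \<forall>\<nu>. u $ \<nu> \<le> x $ \<nu> \<and> x $ \<nu> < u $ \<nu> + 1 / 2 ^ k}"
proof -
  have "\<exists>u. \<forall>x. q2_abs (real_to_q2 x - c $ \<nu>) \<le> 2 powi (- int k) \<longleftrightarrow> u \<le> x \<and> x < u + 1 / 2 ^ k" for \<nu>
    by (rule real_to_q2_interval[of "c $ \<nu>" k]) blast
  then obtain u where u: "\<And>\<nu> x. q2_abs (real_to_q2 x - c $ \<nu>) \<le> 2 powi (- int k) \<longleftrightarrow> u \<nu> \<le> x \<and> x < u \<nu> + 1 / 2 ^ k"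
    by metis
  have "real_vec_to_q2 -` qball c (- int k) = {x. \<forall>\<nu>. (\<chi> i. u i) $ \<nu> \<le> x $ \<nu> \<and> x $ \<nu> < (\<chi> i. u i) $ \<nu> + 1 / 2 ^ k}"
    unfolding vimage_def mem_qball real_vec_to_q2_def vec_lambda_beta u ..
  then show ?thesis by (rule that)
qed

text \<open>Squeezed between the open and the closed box, which have equal Lebesgue measure.\<close>

lemma half_open_box:
  fixes u :: "real ^ 'n::finite"
  assumes "h \<ge> 0"
  defines "S \<equiv> {x. \<forall>\<nu>. u $ \<nu> \<le> x $ \<nu> \<and> x $ \<nu> < u $ \<nu> + h}"
  shows "S \<in> sets borel" "emeasure lborel S = ennreal (h ^ CARD('n))"
proof -
  show S: "S \<in> sets borel" unfolding S_def by measurable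
  define v where "v = u + (\<chi> \<nu>. h)"
  have le: "u \<bullet> b \<le> v \<bullet> b" if "b \<in> Basis" for b
    using that assms(1) by (auto simp: Basis_vec_def v_def inner_axis algebra_simps)
  have "(\<Prod>b\<in>Basis. (v - u) \<bullet> b) = (\<Prod>b\<in>(Basis :: (real ^ 'n) set). h)"
    by (intro prod.cong refl) (auto simp: Basis_vec_def v_def inner_axis)
  then have p: "(\<Prod>b\<in>Basis. (v - u) \<bullet> b) = h ^ CARD('n)" by simp
  have "box u v \<subseteq> S" "S \<subseteq> cbox u v"
    by (auto simp: S_def v_def mem_box_cart less_imp_le)
  then have "emeasure lborel (box u v) \<le> emeasure lborel S" "emeasure lborel S \<le> emeasure lborel (cbox u v)"
    using S by (auto intro!: emeasure_mono)
  then show "emeasure lborel S = ennreal (h ^ CARD('n))"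
    using le p by (simp add: order_antisym)
qed

lemma measurable_real_vec_to_q2: "real_vec_to_q2 \<in> borel \<rightarrow>\<^sub>M (borel :: (q2 ^ 'n::finite) measure)"
proof (rule measurable_sigma_sets[OF sets_borel_qballs])
  fix A :: "(q2 ^ 'n) set" assume "A \<in> qballs"
  then have "A = {} \<or> (\<exists>c k. A = qball c (- int k))" by (auto simp: qballs_def)
  then show "real_vec_to_q2 -` A \<inter> space borel \<in> sets borel"
  proof (elim disjE exE)
    fix c k assume A: "A = qball c (- int k)"
    obtain u where "real_vec_to_q2 -` qball c (- int k) = {x. \<forall>\<nu>. u $ \<nu> \<le> x $ \<nu> \<and> x $ \<nu> < u $ \<nu> + 1 / 2 ^ k}"
      by (rule real_vec_to_q2_box)
    then show ?thesis using half_open_box(1)[of "1 / 2 ^ k" u] by (simp add: A)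
  qed simp
qed auto

lemma invariant_normalized_exists: "\<exists>M :: (q2 ^ 'n::finite) measure. invariant_normalized M"
proof -
  define M where "M = distr lborel (borel :: (q2 ^ 'n) measure) real_vec_to_q2"
  have sM: "sets M = sets borel" by (simp add: M_def)
  have spM: "space M = UNIV" by (simp add: M_def)
  have ball: "emeasure M (qball c (- int k)) = ennreal ((1 / 2 ^ k) ^ CARD('n))" for c k
  proof -
    obtain u where u: "real_vec_to_q2 -` qball c (- int k) = {x. \<forall>\<nu>. u $ \<nu> \<le> x $ \<nu> \<and> x $ \<nu> < u $ \<nu> + 1 / 2 ^ k}"
      by (rule real_vec_to_q2_box)
    have "emeasure M (qball c (- int k)) = emeasure lborel (real_vec_to_q2 -` qball c (- int k) \<inter> space lborel)"
      unfolding M_def by (rule emeasure_distr) (simp_all add: measurable_real_vec_to_q2 open_qball)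
    then show ?thesis using u half_open_box(2)[of "1 / 2 ^ k" u] by simp
  qed
  have meas: "(\<lambda>x. a + x) \<in> measurable M borel" for a
    using measurable_translation measurable_cong_sets[OF sM refl] by blast
  \<comment> \<open>Translation carries balls to balls of the same radius, and the mass of a ball
    under \<open>M\<close> depends on its radius alone.\<close>
  have "distr M borel (\<lambda>x. a + x) = M" for a
  proof (rule measure_eq_of_qballs)
    have e: "emeasure (distr M borel (\<lambda>x. a + x)) (qball c m) = emeasure M (qball (c - a) m)" for c m
      using emeasure_distr[OF meas, of "qball c m" a] by (simp add: open_qball qball_translate spM)
    show "emeasure (distr M borel (\<lambda>x. a + x)) (qball c (- int k)) = emeasure M (qball c (- int k))"
      "emeasure (distr M borel (\<lambda>x. a + x)) (qball c (- int k)) \<noteq> \<infinity>" for c k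
      unfolding e ball by simp_all
  qed (simp_all add: sM)
  moreover have "emeasure M {x. vnorm x \<le> 1} = 1"
    using ball[of 0 0] by (simp add: qball_def)
  ultimately show ?thesis unfolding invariant_normalized_def using sM by blast
qed

lemma invariant_normalized_haar: "invariant_normalized (haar :: (q2 ^ 'n::finite) measure)"
proof -
  have "haar = (THE M :: (q2 ^ 'n) measure. invariant_normalized M)"
    unfolding haar_def invariant_normalized_def ..
  moreover have "M = N" if "invariant_normalized M" "invariant_normalized N" for M N :: "(q2 ^ 'n) measure"
  proof (rule measure_eq_of_qballs)
    show "sets M = sets borel" "sets N = sets borel" using that by (auto simp: invariant_normalized_def)
  qed (use that in \<open>auto simp: emeasure_qball_invariant simp del: power_int_minus\<close>)
  ultimately show ?thesis
    using invariant_normalized_exists theI'[of invariant_normalized] by metis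
qed

section \<open>Characters and their Fourier transforms\<close>

lemma frac2_dyadic: "frac2 t \<in> dyadic"
  and q2_abs_diff_frac2: "q2_abs (t - of_rat (frac2 t)) \<le> 1"
proof -
  have eq: "frac2 t = (THE r. r \<in> dyadic \<and> q2_abs (t - of_rat r) \<le> 1)"
    unfolding frac2_def dyadic_def by (simp add: conj_assoc)
  have "\<exists>!r. r \<in> dyadic \<and> q2_abs (t - of_rat r) \<le> 1"
    using dyadic_exists[of t] dyadic_unique by blast
  from theI'[OF this] show "frac2 t \<in> dyadic" "q2_abs (t - of_rat (frac2 t)) \<le> 1"
    unfolding eq by auto
qed

lemma dyadicE:
  assumes "r \<in> dyadic"
  obtains m k :: nat where "r = of_nat m / 2 ^ k"
  using assms by (auto simp: dyadic_def)

text \<open>\<open>frac2 s + frac2 t\<close> may leave [0,1), so uniqueness of the representative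
  does not apply; what remains is that two dyadic fractions congruent modulo the 2-adic integers
  differ by an integer.\<close>

lemma frac2_add: "frac2 (s + t) - (frac2 s + frac2 t) \<in> \<int>"
proof -
  obtain m k where a: "frac2 (s + t) = of_nat m / 2 ^ k" by (rule dyadicE[OF frac2_dyadic])
  obtain m1 k1 where b: "frac2 s = of_nat m1 / 2 ^ k1" by (rule dyadicE[OF frac2_dyadic])
  obtain m2 k2 where c: "frac2 t = of_nat m2 / 2 ^ k2" by (rule dyadicE[OF frac2_dyadic])
  have bc: "frac2 s + frac2 t = of_nat (m1 * 2 ^ k2 + m2 * 2 ^ k1) / 2 ^ (k1 + k2)"
    unfolding b c by (simp add: field_simps power_add)
  have "q2_abs ((s - of_rat (frac2 s)) + (t - of_rat (frac2 t)) - (s + t - of_rat (frac2 (s + t)))) \<le> 1"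
    by (intro q2_abs_diff_le q2_abs_add_le q2_abs_diff_frac2)
  then have "q2_abs (of_rat (frac2 (s + t) - (frac2 s + frac2 t))) \<le> 1"
    by (simp add: of_rat_diff of_rat_add algebra_simps)
  then show ?thesis unfolding bc unfolding a by (rule dyadic_diff_integral)
qed

lemma chi2_add: "chi2 (s + t) = chi2 s * chi2 t"
proof -
  obtain z where "frac2 (s + t) - (frac2 s + frac2 t) = of_int z"
    using frac2_add[of s t] by (auto elim: Ints_cases)
  then have z: "frac2 (s + t) = frac2 s + frac2 t + of_int z" by simp
  show ?thesis unfolding chi2_def z exp_add[symmetric] exp_eq
    by (rule exI[of _ z]) (simp add: of_rat_add algebra_simps)
qed

lemma chi2_cis: "chi2 t = cis (2 * pi * of_rat (frac2 t))"
proof -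
  obtain m k where "frac2 t = of_nat m / 2 ^ k" by (rule dyadicE[OF frac2_dyadic])
  then show ?thesis
    by (simp add: chi2_def cis_conv_exp of_rat_divide of_rat_power mult_ac)
qed

lemma norm_chi2: "norm (chi2 t) = 1"
  by (simp add: chi2_cis)

lemma chi2_nonzero [simp]: "chi2 t \<noteq> 0"
  by (simp add: chi2_def)

text \<open>The value 1 means that \<open>frac2 t\<close> is an integer, and 0 is the only integer
  in [0,1).\<close>

lemma chi2_eq_1_iff: "chi2 t = 1 \<longleftrightarrow> q2_abs t \<le> 1"
proof
  assume "chi2 t = 1"
  then obtain z :: int where "2 * pi * of_rat (frac2 t) = of_int (2 * z) * pi"
    unfolding chi2_cis cis_conv_exp exp_eq_1 by auto
  then have "of_rat (frac2 t) = (of_int z :: real)" by simp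
  then have z: "frac2 t = of_int z" by (metis of_rat_eq_iff of_rat_of_int_eq)
  have "0 \<le> frac2 t" "frac2 t < 1" using frac2_dyadic[of t] by (auto simp: dyadic_def)
  then have "z = 0" unfolding z by simp
  then show "q2_abs t \<le> 1" using q2_abs_diff_frac2[of t] by (simp add: z)
next
  assume t: "q2_abs t \<le> 1"
  have "0 \<in> dyadic" by (auto simp: dyadic_def intro!: exI[of _ 0])
  then have "frac2 t = 0" using dyadic_unique[of "frac2 t" 0 t] frac2_dyadic q2_abs_diff_frac2 t by simp
  then show "chi2 t = 1" by (simp add: chi2_def)
qed

lemma chi2_cong:
  assumes "q2_abs (s - t) \<le> 1"
  shows "chi2 s = chi2 t"
  using chi2_add[of "s - t" t] assms by (simp add: chi2_eq_1_iff[symmetric])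

lemma vdot_add_left: "vdot (\<xi> + \<eta>) x = vdot \<xi> x + vdot \<eta> x"
  by (simp add: vdot_def sum.distrib algebra_simps)

lemma vdot_add_right: "vdot \<xi> (x + y) = vdot \<xi> x + vdot \<xi> y"
  by (simp add: vdot_def sum.distrib algebra_simps)

lemma vdot_minus_left: "vdot (- \<xi>) x = - vdot \<xi> x"
  by (simp add: vdot_def sum_negf)

lemma vdot_minus_right: "vdot \<xi> (- x) = - vdot \<xi> x"
  by (simp add: vdot_def sum_negf)

lemma vdot_diff_right: "vdot \<xi> (x - y) = vdot \<xi> x - vdot \<xi> y"
  using vdot_add_right[of \<xi> x "- y"] by (simp add: vdot_minus_right)

lemma vdot_commute: "vdot \<xi> x = vdot x \<xi>"
  by (simp add: vdot_def mult.commute)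

text \<open>Balls of radii \<open>2 powi m\<close> and \<open>2 powi (- m)\<close> about 0 are dual
  to each other under the pairing; this governs where characters are constant.\<close>

lemma q2_abs_vdot_le:
  assumes "vnorm \<xi> \<le> 2 powi (- m)" "vnorm x \<le> 2 powi m"
  shows "q2_abs (vdot \<xi> x) \<le> 1"
  unfolding vdot_def
proof (rule q2_abs_sum_le)
  fix \<nu>
  have "q2_abs (\<xi> $ \<nu>) * q2_abs (x $ \<nu>) \<le> 2 powi (- m) * 2 powi m"
    using assms by (intro mult_mono) (auto simp: vnorm_le_iff)
  then show "q2_abs (\<xi> $ \<nu> * x $ \<nu>) \<le> 1" by (simp add: q2_abs_mult flip: power_int_add)
qed simp

lemma chi2_vdot_cong_qball:
  assumes "vnorm \<zeta> \<le> 2 powi (- m)" "x \<in> qball c m"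
  shows "chi2 (vdot \<zeta> x) = chi2 (vdot \<zeta> c)"
  using q2_abs_vdot_le[OF assms(1), of "x - c"] assms(2)
  by (intro chi2_cong) (simp add: qball_def vdot_diff_right)

section \<open>Characters cut off to balls\<close>

definition wave :: "q2 ^ 'n::finite \<Rightarrow> q2 ^ 'n \<Rightarrow> int \<Rightarrow> q2 ^ 'n \<Rightarrow> complex" where
  "wave \<eta> c m x = (if x \<in> qball c m then chi2 (vdot \<eta> x) else 0)"

lemma locally_constant_wave: "locally_constant (wave \<eta> c m)"
  unfolding locally_constant_def
proof
  fix x
  show "\<exists>U. open U \<and> x \<in> U \<and> wave \<eta> c m constant_on U"
  proof (cases "x \<in> qball c m")
    case True
    \<comment> \<open>On balls of radius \<open>2 powi (- int k)\<close> a character whose frequency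
      has norm at most \<open>2 ^ k\<close> is constant.\<close>
    obtain k :: nat where "vnorm \<eta> \<le> 2 ^ k"
      using real_arch_pow[of 2 "vnorm \<eta>"] by (auto intro: less_imp_le)
    then have near: "chi2 (vdot \<eta> y) = chi2 (vdot \<eta> x)" if "y \<in> qball x (- int k)" for y
      using that by (intro chi2_vdot_cong_qball[of _ "- int k"]) auto
    have "wave \<eta> c m y = chi2 (vdot \<eta> x)" if "y \<in> qball c m \<inter> qball x (- int k)" for y
      using that near[of y] by (simp only: wave_def Int_iff if_True)
    then have "wave \<eta> c m constant_on qball c m \<inter> qball x (- int k)"
      unfolding constant_on_def by blast
    then show ?thesis using True by (intro exI[of _ "qball c m \<inter> qball x (- int k)"]) (simp add: open_qball open_Int)
  next
    case False
    then have "wave \<eta> c m constant_on - qball c m"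
      unfolding constant_on_def wave_def by simp
    then show ?thesis using False by (intro exI[of _ "- qball c m"]) (simp add: closed_qball open_Compl)
  qed
qed

lemma locally_constant_add:
  assumes "locally_constant f" "locally_constant g"
  shows "locally_constant (\<lambda>x. f x + g x)"
  unfolding locally_constant_def
proof
  fix x
  obtain U V a b where "open U" "x \<in> U" "\<forall>y\<in>U. f y = a" "open V" "x \<in> V" "\<forall>y\<in>V. g y = b"
    using assms unfolding locally_constant_def constant_on_def by metis
  then show "\<exists>U. open U \<and> x \<in> U \<and> (\<lambda>x. f x + g x) constant_on U"
    unfolding constant_on_def by (intro exI[of _ "U \<inter> V"]) auto
qed

lemma locally_constant_compose: "locally_constant f \<Longrightarrow> locally_constant (\<lambda>x. h (f x))"
  unfolding locally_constant_def constant_on_def by metis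

lemma locally_constant_sum:
  "(\<And>i. i \<in> I \<Longrightarrow> locally_constant (f i)) \<Longrightarrow> locally_constant (\<lambda>x. \<Sum>i\<in>I. f i x)"
proof (induction I rule: infinite_finite_induct)
  case (insert i I)
  then show ?case by (simp add: locally_constant_add)
qed (auto simp: locally_constant_def constant_on_def)

lemma borel_measurable_locally_constant:
  assumes "locally_constant f"
  shows "f \<in> borel_measurable borel"
proof (rule borel_measurableI)
  fix S :: "'b set" assume "open S"
  have "open (f -` S)"
  proof (subst open_subopen, intro ballI)
    fix x assume "x \<in> f -` S"
    then show "\<exists>T. open T \<and> x \<in> T \<and> T \<subseteq> f -` S"
      using assms unfolding locally_constant_def constant_on_def by (metis subsetI vimageE vimageI)
  qed
  then show "f -` S \<inter> space borel \<in> sets borel" by simp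
qed

lemma sets_haar: "sets (haar :: (q2 ^ 'n::finite) measure) = sets borel"
  and distr_haar: "distr haar borel (\<lambda>x. a + x) = (haar :: (q2 ^ 'n) measure)"
  using invariant_normalized_haar unfolding invariant_normalized_def by blast+

lemma emeasure_haar_qball: "emeasure haar (qball (c :: q2 ^ 'n::finite) m) = ennreal ((2 powi m) ^ CARD('n))"
  by (rule emeasure_qball_invariant[OF invariant_normalized_haar])

lemma borel_measurable_wave: "wave \<eta> c m \<in> borel_measurable borel"
  by (rule borel_measurable_locally_constant[OF locally_constant_wave])

lemma integrable_wave: "integrable haar (wave \<eta> c m)"
proof (rule integrableI_bounded_set[of "qball c m" _ _ 1])
  show "wave \<eta> c m \<in> borel_measurable haar"
    using borel_measurable_wave measurable_cong_sets[OF sets_haar refl] by blast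
qed (auto simp: sets_haar open_qball emeasure_haar_qball wave_def norm_chi2)

text \<open>In the dual ball the character is constant on the support. Otherwise some translation
  \<open>u\<close> preserves the ball but multiplies the integrand by a constant other than 1, and
  invariance forces the integral to be 0.\<close>

lemma integral_wave:
  fixes \<zeta> :: "q2 ^ 'n::finite"
  shows "(LINT x|haar. wave \<zeta> c m x) =
    (if vnorm \<zeta> \<le> 2 powi (- m) then (2 powi m) ^ CARD('n) * chi2 (vdot \<zeta> c) else 0)"
proof (cases "vnorm \<zeta> \<le> 2 powi (- m)")
  case True
  then have "wave \<zeta> c m = (\<lambda>x. indicator (qball c m) x *\<^sub>R chi2 (vdot \<zeta> c))"
    using chi2_vdot_cong_qball[OF True] by (auto simp: wave_def)
  then have "(LINT x|haar. wave \<zeta> c m x) = measure haar (qball c m) *\<^sub>R chi2 (vdot \<zeta> c)"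
    by (simp add: sets_haar open_qball emeasure_haar_qball)
  also have "measure haar (qball c m) = (2 powi m) ^ CARD('n)"
    by (simp add: measure_def emeasure_haar_qball)
  finally show ?thesis using True by (simp add: scaleR_conv_of_real)
next
  case False
  obtain \<nu> where \<nu>: "vnorm \<zeta> = q2_abs (\<zeta> $ \<nu>)" by (rule vnorm_attained)
  \<comment> \<open>Concentrated in a coordinate where \<open>\<zeta>\<close> attains its norm and
    as large as the ball permits, which makes \<open>q2_abs (vdot \<zeta> u)\<close> exceed
    1.\<close>
  define u :: "q2 ^ 'n" where "u = (\<chi> i. if i = \<nu> then 2 powi (- m) else 0)"
  have "vdot \<zeta> u = (\<Sum>i\<in>UNIV. if i = \<nu> then \<zeta> $ i * 2 powi (- m) else 0)"
    unfolding vdot_def u_def by (intro sum.cong) auto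
  then have zu: "vdot \<zeta> u = \<zeta> $ \<nu> * 2 powi (- m)" by simp
  have "2 powi (- m) * 2 powi m < vnorm \<zeta> * (2 powi m :: real)"
    using False by (intro mult_strict_right_mono) auto
  then have "\<not> q2_abs (vdot \<zeta> u) \<le> 1"
    unfolding zu q2_abs_mult q2_abs_2_powi \<nu> by (simp flip: power_int_add)
  then have ne: "chi2 (vdot \<zeta> u) \<noteq> 1" by (simp add: chi2_eq_1_iff)
  have "u \<in> qball 0 m" by (auto simp: mem_qball u_def q2_abs_2_powi simp del: power_int_minus)
  then have "u + x \<in> qball x m" for x by (simp add: mem_qball)
  then have "u + x \<in> qball c m \<longleftrightarrow> x \<in> qball c m" for x
    by (metis centre_in_qball qball_recentre)
  then have shift: "wave \<zeta> c m (u + x) = chi2 (vdot \<zeta> u) * wave \<zeta> c m x" for x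
    by (simp add: wave_def vdot_add_right chi2_add)
  have meas: "(\<lambda>x. u + x) \<in> haar \<rightarrow>\<^sub>M borel"
    using measurable_translation measurable_cong_sets[OF sets_haar refl] by blast
  have "(LINT x|haar. wave \<zeta> c m x) = (LINT x|distr haar borel (\<lambda>x. u + x). wave \<zeta> c m x)"
    by (simp only: distr_haar)
  also have "\<dots> = (LINT x|haar. wave \<zeta> c m (u + x))"
    by (rule integral_distr[OF meas borel_measurable_wave])
  also have "\<dots> = chi2 (vdot \<zeta> u) * (LINT x|haar. wave \<zeta> c m x)"
    unfolding shift by simp
  finally show ?thesis using ne False by simp
qed

lemma chi2_mult_wave: "chi2 (vdot \<xi> x) * wave \<eta> c m x = wave (\<xi> + \<eta>) c m x"
  by (simp add: wave_def vdot_add_left chi2_add)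

text \<open>The kernel only shifts the frequency to \<open>\<xi> + \<eta>\<close>. Read as a
  function of \<open>\<xi>\<close>, the resulting integral is supported on the ball about
  \<open>- \<eta>\<close> and carries the character of frequency \<open>c i\<close>.\<close>

lemma fourier_sum_wave:
  "fourier (\<lambda>x. \<Sum>i\<in>I. C i * wave \<eta> (c i) m x) \<xi> =
   (\<Sum>i\<in>I. C i * (2 powi m) ^ CARD('n) * chi2 (vdot \<eta> (c i)) * wave (c i) (- \<eta> :: q2 ^ 'n::finite) (- m) \<xi>)"
proof -
  have "fourier (\<lambda>x. \<Sum>i\<in>I. C i * wave \<eta> (c i) m x) \<xi> =
      (LINT x|haar. (\<Sum>i\<in>I. C i * wave (\<xi> + \<eta>) (c i) m x))"
    unfolding fourier_def chi2_mult_wave[symmetric] by (simp add: sum_distrib_left mult_ac)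
  also have "\<dots> = (\<Sum>i\<in>I. C i * (LINT x|haar. wave (\<xi> + \<eta>) (c i) m x))"
    by (simp add: integral_sum integrable_wave)
  also have "\<dots> = (\<Sum>i\<in>I. C i * (2 powi m) ^ CARD('n) * chi2 (vdot \<eta> (c i)) * wave (c i) (- \<eta>) (- m) \<xi>)"
    unfolding integral_wave
    by (intro sum.cong refl)
      (simp add: wave_def qball_def vdot_add_left chi2_add vdot_commute[of \<xi>] mult_ac)
  finally show ?thesis .
qed

lemma inv_fourier_sum_wave:
  "inv_fourier (\<lambda>\<xi>. \<Sum>i\<in>I. C i * wave (c i) (- \<eta>) (- m) \<xi>) x =
   (\<Sum>i\<in>I. C i * (2 powi (- m)) ^ CARD('n) * chi2 (vdot \<eta> (x - c i)) * (if x \<in> qball (c i) m then 1 else 0))"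
  for \<eta> :: "q2 ^ 'n::finite"
proof -
  have "inv_fourier (\<lambda>\<xi>. \<Sum>i\<in>I. C i * wave (c i) (- \<eta>) (- m) \<xi>) x =
      (LINT \<xi>|haar. (\<Sum>i\<in>I. C i * wave (- x + c i) (- \<eta>) (- m) \<xi>))"
    unfolding inv_fourier_def chi2_mult_wave[symmetric] by (simp add: sum_distrib_left mult_ac)
  also have "\<dots> = (\<Sum>i\<in>I. C i * (LINT \<xi>|haar. wave (- x + c i) (- \<eta>) (- m) \<xi>))"
    by (simp add: integral_sum integrable_wave)
  also have "\<dots> = (\<Sum>i\<in>I. C i * (2 powi (- m)) ^ CARD('n) * chi2 (vdot \<eta> (x - c i)) * (if x \<in> qball (c i) m then 1 else 0))"
  proof (intro sum.cong refl)
    fix i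
    have "vdot (- x + c i) (- \<eta>) = vdot \<eta> (x - c i)"
      by (subst vdot_commute) (simp add: vdot_minus_left vdot_diff_right)
    moreover have "vnorm (- x + c i) = vnorm (x - c i)"
      using vnorm_minus_commute[of "c i" x] by simp
    ultimately show "C i * (LINT \<xi>|haar. wave (- x + c i) (- \<eta>) (- m) \<xi>) =
        C i * (2 powi (- m)) ^ CARD('n) * chi2 (vdot \<eta> (x - c i)) * (if x \<in> qball (c i) m then 1 else 0)"
      unfolding integral_wave by (simp add: qball_def)
  qed
  finally show ?thesis .
qed

text \<open>A perturbation strictly smaller than the largest coordinate leaves that coordinate's
  absolute value unchanged, and no other coordinate can overtake it.\<close>

lemma vnorm_eq_on_qball:
  assumes "\<xi> \<in> qball (- \<eta>) l" "2 powi l < vnorm \<eta>"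
  shows "vnorm \<xi> = vnorm \<eta>"
proof -
  have le: "q2_abs (\<xi> $ i + \<eta> $ i) \<le> 2 powi l" for i using assms(1) by (simp add: mem_qball)
  obtain \<nu> where \<nu>: "vnorm \<eta> = q2_abs (\<eta> $ \<nu>)" by (rule vnorm_attained)
  have "q2_abs (- \<eta> $ \<nu> + (\<xi> $ \<nu> + \<eta> $ \<nu>)) = q2_abs (- \<eta> $ \<nu>)"
    using le[of \<nu>] assms(2) \<nu> by (intro q2_abs_add_eq) simp
  then have "vnorm \<eta> \<le> vnorm \<xi>" using q2_abs_le_vnorm[of \<xi> \<nu>] \<nu> by simp
  moreover have "q2_abs (\<xi> $ i) \<le> vnorm \<eta>" for i
    using q2_abs_diff_le[of "\<xi> $ i + \<eta> $ i" "vnorm \<eta>" "\<eta> $ i"] le[of i] assms(2) q2_abs_le_vnorm[of \<eta> i] by simp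
  then have "vnorm \<xi> \<le> vnorm \<eta>" by (simp add: vnorm_le_iff)
  ultimately show ?thesis by simp
qed

lemma taibleson_sum_wave:
  fixes \<eta> :: "q2 ^ 'n::finite"
  assumes "2 powi (- m) < vnorm \<eta>"
  shows "taibleson \<alpha> (\<lambda>x. \<Sum>i\<in>I. C i * wave \<eta> (c i) m x) =
    (\<lambda>x. of_real (vnorm \<eta>) powr \<alpha> * (\<Sum>i\<in>I. C i * wave \<eta> (c i) m x))"
proof
  fix x
  define D where "D = (\<lambda>i. of_real (vnorm \<eta>) powr \<alpha> * (C i * (2 powi m) ^ CARD('n) * chi2 (vdot \<eta> (c i))))"
  \<comment> \<open>Off the ball about \<open>- \<eta>\<close> both sides are 0, so only the
    constant value of the symbol on that ball enters; the origin lies outside it.\<close>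
  have "of_real (vnorm \<xi>) powr \<alpha> * fourier (\<lambda>x. \<Sum>i\<in>I. C i * wave \<eta> (c i) m x) \<xi> =
      (\<Sum>i\<in>I. D i * wave (c i) (- \<eta>) (- m) \<xi>)" for \<xi>
    unfolding fourier_sum_wave sum_distrib_left
    by (intro sum.cong refl) (auto simp: D_def wave_def vnorm_eq_on_qball[OF _ assms])
  then have "taibleson \<alpha> (\<lambda>x. \<Sum>i\<in>I. C i * wave \<eta> (c i) m x) x =
      (\<Sum>i\<in>I. D i * (2 powi (- m)) ^ CARD('n) * chi2 (vdot \<eta> (x - c i)) * (if x \<in> qball (c i) m then 1 else 0))"
    unfolding taibleson_def by (simp add: inv_fourier_sum_wave)
  also have "\<dots> = (\<Sum>i\<in>I. of_real (vnorm \<eta>) powr \<alpha> * (C i * wave \<eta> (c i) m x))"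
  proof (intro sum.cong refl)
    fix i
    have "chi2 (vdot \<eta> (c i)) * chi2 (vdot \<eta> (x - c i)) = chi2 (vdot \<eta> x)"
      by (simp add: vdot_diff_right flip: chi2_add)
    moreover have "((2 powi m) ^ CARD('n) * (2 powi (- m)) ^ CARD('n) :: complex) = 1"
      by (simp add: power_int_minus power_inverse)
    ultimately show "D i * (2 powi (- m)) ^ CARD('n) * chi2 (vdot \<eta> (x - c i)) * (if x \<in> qball (c i) m then 1 else 0) =
        of_real (vnorm \<eta>) powr \<alpha> * (C i * wave \<eta> (c i) m x)"
      unfolding D_def wave_def by (auto simp: mult_ac)
  qed
  also have "\<dots> = of_real (vnorm \<eta>) powr \<alpha> * (\<Sum>i\<in>I. C i * wave \<eta> (c i) m x)"
    by (simp add: sum_distrib_left)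
  finally show "taibleson \<alpha> (\<lambda>x. \<Sum>i\<in>I. C i * wave \<eta> (c i) m x) x = of_real (vnorm \<eta>) powr \<alpha> * (\<Sum>i\<in>I. C i * wave \<eta> (c i) m x)" .
qed

text \<open>The mean vanishes because the frequency lies outside the ball dual to the supports, so
  each term integrates to 0.\<close>

lemma sum_wave_lizorkin:
  assumes "finite I" "2 powi (- m) < vnorm \<eta>"
  shows "(\<lambda>x. \<Sum>i\<in>I. C i * wave \<eta> (c i) m x) \<in> lizorkin"
  unfolding lizorkin_def
proof (intro CollectI conjI)
  show "locally_constant (\<lambda>x. \<Sum>i\<in>I. C i * wave \<eta> (c i) m x)"
    by (intro locally_constant_sum locally_constant_compose[where h = "\<lambda>z. _ * z"] locally_constant_wave)
  let ?S = "{x. (\<Sum>i\<in>I. C i * wave \<eta> (c i) m x) \<noteq> 0}"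
  have K: "compact (\<Union>i\<in>I. qball (c i) m)"
    using assms(1) compact_qball by (intro compact_UN) auto
  have "?S \<subseteq> (\<Union>i\<in>I. qball (c i) m)"
  proof
    fix x assume "x \<in> ?S"
    then have "\<exists>i\<in>I. wave \<eta> (c i) m x \<noteq> 0"
      by (auto dest: sum.not_neutral_contains_not_neutral)
    then show "x \<in> (\<Union>i\<in>I. qball (c i) m)" by (auto simp: wave_def split: if_splits)
  qed
  then have "closure ?S \<subseteq> (\<Union>i\<in>I. qball (c i) m)"
    using K by (intro closure_minimal compact_imp_closed)
  then show "compact (closure ?S)"
    using compact_Int_closed[OF K closed_closure[of ?S]] by (simp add: Int_absorb1)
  show "(LINT x|haar. (\<Sum>i\<in>I. C i * wave \<eta> (c i) m x)) = 0"
    using assms(2) by (simp add: integral_sum integrable_wave integral_wave)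
qed

section \<open>The wavelets\<close>

lemma exp_root_sum:
  assumes "r < N"
  shows "(\<Sum>k<N. exp (- (2 * of_real pi * \<i> * of_nat r / of_nat N)) ^ k) = (if r = 0 then of_nat N else (0 :: complex))"
proof (cases "r = 0")
  case False
  let ?w = "exp (- (2 * of_real pi * \<i> * of_nat r / of_nat N)) :: complex"
  have N: "N > 0" using assms by simp
  have "?w \<noteq> 1"
  proof
    assume "?w = 1"
    then obtain z :: int where "- (2 * pi * real r / real N) = of_int (2 * z) * pi"
      unfolding exp_eq_1 by auto
    then have "pi * (- real r) = pi * (of_int z * real N)" using N by (simp add: field_simps)
    then have "- real r = of_int z * real N" by (metis mult_left_cancel pi_neq_zero)
    then have "- int r = z * int N" by (metis of_int_eq_iff of_int_minus of_int_mult of_int_of_nat_eq)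
    then have "int N dvd int r" by (metis dvd_minus_iff dvd_triv_right)
    then show False using assms False by (simp add: nat_dvd_not_less)
  qed
  moreover have "?w ^ N = exp (2 * of_int (- int r) * of_real pi * \<i>)"
    using N by (simp add: mult_ac flip: exp_of_nat_mult)
  moreover have "exp (2 * of_int (- int r) * of_real pi * \<i>) = 1"
    using exp_integer_2pi[of "of_int (- int r)"] by simp
  ultimately show ?thesis using False by (simp add: sum_gp_strict)
qed simp

text \<open>Fourier inversion on \<open>\<int>/2\<^sup>s\<close>: not all coefficients can vanish since \<open>\<bar>\<gamma>\<^sub>0\<bar> = 1\<close>.\<close>

lemma admissible_nonzero:
  assumes "admissible s A"
  shows "\<exists>k<2 ^ s. A 1 k \<noteq> 0"
proof (cases "s \<ge> 1")
  case True
  define N :: nat where "N = 2 ^ s"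
  obtain \<gamma> where \<gamma>: "\<And>r. r < N \<Longrightarrow> cmod (\<gamma> r) = 1"
    and A: "\<And>k. k < N \<Longrightarrow> A 1 k = 1 / 2 ^ s * (-1) ^ k *
      (\<Sum>r<N. \<gamma> r * exp (- \<i> * of_real pi * ((2 * of_nat r + 1) / 2 ^ s) * of_nat k))"
    using assms True unfolding admissible_def N_def by auto
  have N: "N > 0" "of_nat N = (2 ^ s :: complex)" by (simp_all add: N_def)
  show ?thesis
  proof (rule ccontr)
    assume "\<not> ?thesis"
    then have "A 1 k = 0" if "k < N" for k using that by (auto simp: N_def)
    then have z: "(\<Sum>r<N. \<gamma> r * exp (- \<i> * of_real pi * ((2 * of_nat r + 1) / 2 ^ s) * of_nat k)) = 0" if "k < N" for k
      using A that by fastforce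
    \<comment> \<open>The factor \<open>exp (\<i> * of_real pi * of_nat k / 2 ^ s)\<close> removes
      the half-step shift caused by the 1 in \<open>2 * of_nat r + 1\<close>. Powers of
      \<open>2 ^ s\<close>-th roots of unity remain, and their sum over \<open>k\<close> isolates
      \<open>r = 0\<close>.\<close>
    have term_eq: "exp (\<i> * of_real pi * of_nat k / 2 ^ s) * (\<gamma> r * exp (- \<i> * of_real pi * ((2 * of_nat r + 1) / 2 ^ s) * of_nat k))
        = \<gamma> r * exp (- (2 * of_real pi * \<i> * of_nat r / of_nat N)) ^ k" for r k
    proof -
      have "exp (\<i> * of_real pi * of_nat k / 2 ^ s) * exp (- \<i> * of_real pi * ((2 * of_nat r + 1) / 2 ^ s) * of_nat k)
          = exp (of_nat k * (- (2 * of_real pi * \<i> * of_nat r / of_nat N)))"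
        unfolding exp_add[symmetric] N(2) by (rule arg_cong[of _ _ exp]) (simp add: field_simps)
      then show ?thesis by (simp only: exp_of_nat_mult mult.left_commute)
    qed
    have "0 = (\<Sum>k<N. exp (\<i> * of_real pi * of_nat k / 2 ^ s) *
        (\<Sum>r<N. \<gamma> r * exp (- \<i> * of_real pi * ((2 * of_nat r + 1) / 2 ^ s) * of_nat k)))"
      using z by (intro sum.neutral[symmetric]) simp
    also have "\<dots> = (\<Sum>r<N. \<gamma> r * (\<Sum>k<N. exp (- (2 * of_real pi * \<i> * of_nat r / of_nat N)) ^ k))"
      unfolding sum_distrib_left term_eq by (rule sum.swap)
    also have "\<dots> = (\<Sum>r<N. if r = 0 then \<gamma> r * of_nat N else 0)"
      by (intro sum.cong refl) (simp add: exp_root_sum)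
    also have "\<dots> = \<gamma> 0 * of_nat N" using N(1) by simp
    finally show False using \<gamma>[OF N(1)] N(1) by auto
  qed
next
  case False
  then show ?thesis using assms by (intro exI[of _ 0]) (simp add: admissible_def)
qed

section \<open>Reduction of the wavelets to cut-off characters\<close>

definition kfreq :: "'n set \<Rightarrow> int \<Rightarrow> q2 ^ 'n::finite" where
  "kfreq e j = (\<chi> \<nu>. 2 powi (j - 1) * of_nat (kvec e \<nu>))"

lemma vnorm_kfreq:
  assumes "e \<noteq> {}"
  shows "vnorm (kfreq e j) = 2 powi (1 - j)"
proof (rule antisym)
  have p: "q2_abs (2 powi (j - 1)) = 2 powi (1 - j)" using q2_abs_2_powi[of "j - 1"] by simp
  then show "vnorm (kfreq e j) \<le> 2 powi (1 - j)"
    by (auto simp: vnorm_le_iff kfreq_def kvec_def)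
  obtain \<nu> where "\<nu> \<in> e" using assms by blast
  then show "2 powi (1 - j) \<le> vnorm (kfreq e j)"
    using q2_abs_le_vnorm[of "kfreq e j" \<nu>] p by (simp add: kfreq_def kvec_def)
qed

text \<open>Dilation by \<open>2 powi j\<close> turns the unit ball about \<open>b\<close> into the
  ball of radius \<open>2 powi j\<close> about \<open>2 powi (- j) *s b\<close> and moves its factor
  into the frequency; the translation contributes only a constant phase.\<close>

lemma Psi0_eq_wave:
  "Psi0 e ((2 powi j) *s x - b) =
    chi2 (- (inverse 2 * vdot (\<chi> \<nu>. of_nat (kvec e \<nu>)) b)) * wave (kfreq e j) ((2 powi (- j)) *s b) j x"
proof -
  let ?k = "\<chi> \<nu>. of_nat (kvec e \<nu>)"
  have "inverse 2 * vdot ?k ((2 powi j) *s x) = vdot (kfreq e j) x"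
    unfolding vdot_def sum_distrib_left
    by (intro sum.cong refl) (simp add: kfreq_def power_int_diff field_simps)
  then have 1: "chi2 (inverse 2 * vdot ?k ((2 powi j) *s x - b)) = chi2 (- (inverse 2 * vdot ?k b)) * chi2 (vdot (kfreq e j) x)"
    by (simp add: vdot_diff_right right_diff_distrib flip: chi2_add)
  have "vnorm ((2 powi j) *s x - b) \<le> 1 \<longleftrightarrow> x \<in> qball ((2 powi (- j)) *s b) j"
    using q2_abs_scale_le[of "x $ _" j "b $ _" 0]
    by (simp add: vnorm_le_iff mem_qball)
  then have 2: "Omega (vnorm ((2 powi j) *s x - b)) = (if x \<in> qball ((2 powi (- j)) *s b) j then 1 else 0)"
    by (simp add: Omega_def)
  show ?thesis unfolding Psi0_def 1 2 by (simp add: wave_def)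
qed

text \<open>The base is a positive real, so \<open>Ln\<close> is its real logarithm and complex
  exponents meet no branch problem. This turns the symbol at \<open>kfreq e j\<close> into the
  eigenvalue.\<close>

lemma of_real_2_powi_powr:
  "(of_real (2 powi k) :: complex) powr \<alpha> = 2 powr (\<alpha> * of_int k)"
proof -
  have "(2 :: real) powi k = 2 powr of_int k" by (simp add: powr_real_of_int')
  then have "ln ((2 :: real) powi k) = of_int k * ln 2" by (simp add: ln_powr)
  moreover have "Ln (of_real (2 powi k)) = of_real (ln (2 powi k))" "Ln 2 = of_real (ln 2)"
    using Ln_of_real[of "2 powi k"] Ln_of_real[of 2] by simp_all
  ultimately show ?thesis by (simp add: powr_def mult_ac)
qed

theorem corollary6p2:
  fixes s :: "'n::finite \<Rightarrow> nat"
    and A :: "'n \<Rightarrow> nat \<Rightarrow> nat \<Rightarrow> complex"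
    and e :: "'n set"
    and j :: int
    and a :: "q2 ^ 'n"
    and \<alpha> :: complex
  assumes "\<And>\<nu>. admissible (s \<nu>) (A \<nu>)"
    and "e \<noteq> {}"
    and "\<And>\<nu>. a $ \<nu> \<in> I2"
  shows "eigenfunction_on lizorkin (taibleson \<alpha>) (Psi s A e j a) (2 powr (\<alpha> * (1 - of_int j)))"
proof -
  define R where "R = {r :: 'n \<Rightarrow> nat. \<forall>\<nu>. r \<nu> < 2 ^ s \<nu>}"
  define b where "b = (\<lambda>r :: 'n \<Rightarrow> nat. a + (\<chi> \<nu>. of_nat (r \<nu>) / 2 ^ s \<nu> * of_nat (kvec e \<nu>)))"
  define c where "c = (\<lambda>r. (2 powi (- j)) *s b r)"
  \<comment> \<open>The phase caused by the translation \<open>b r\<close> is absorbed into the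
    coefficient; what remains are waves of one common frequency.\<close>
  define C where "C = (\<lambda>r. of_real (2 powr (- (real CARD('n) * real_of_int j / 2))) *
    (\<Prod>\<nu>\<in>UNIV. A \<nu> (kvec e \<nu>) (r \<nu>)) * chi2 (- (inverse 2 * vdot (\<chi> \<nu>. of_nat (kvec e \<nu>)) (b r))))"
  have Psi: "Psi s A e j a = (\<lambda>x. \<Sum>r\<in>R. C r * wave (kfreq e j) (c r) j x)"
  proof
    fix x
    have "(2 powi j) *s x - a - (\<chi> \<nu>. of_nat (r \<nu>) / 2 ^ s \<nu> * of_nat (kvec e \<nu>)) = (2 powi j) *s x - b r" for r
      by (simp only: b_def diff_diff_eq)
    then show "Psi s A e j a x = (\<Sum>r\<in>R. C r * wave (kfreq e j) (c r) j x)"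
      unfolding Psi_def R_def[symmetric] by (simp only: Psi0_eq_wave C_def c_def sum_distrib_left mult.assoc)
  qed

  \<comment> \<open>The bounds vary with \<open>\<nu>\<close>; the largest one places
    \<open>R\<close> inside a finite function space.\<close>
  have "R = (UNIV \<rightarrow>\<^sub>E {..<2 ^ Max (range s)}) \<inter> R"
  proof -
    have "2 ^ s \<nu> \<le> (2 :: nat) ^ Max (range s)" for \<nu> by (intro power_increasing Max_ge) auto
    then show ?thesis unfolding R_def by (fastforce intro: less_le_trans)
  qed
  then have finR: "finite R" by (metis finite_Int finite_PiE finite finite_lessThan)
  have gap: "2 powi (- j) < vnorm (kfreq e j)"
    unfolding vnorm_kfreq[OF assms(2)] by (rule power_int_strict_increasing) auto
  have "\<exists>k<2 ^ s \<nu>. A \<nu> (kvec e \<nu>) k \<noteq> 0" for \<nu>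
  proof (cases "\<nu> \<in> e")
    case False
    then have "A \<nu> (kvec e \<nu>) 0 = 1" using assms(1)[of \<nu>] by (simp add: kvec_def admissible_def)
    then show ?thesis by (intro exI[of _ 0]) simp
  qed (use admissible_nonzero[OF assms(1)] in \<open>simp add: kvec_def\<close>)
  then obtain r0 where r0: "\<And>\<nu>. r0 \<nu> < 2 ^ s \<nu>" "\<And>\<nu>. A \<nu> (kvec e \<nu>) (r0 \<nu>) \<noteq> 0" by metis
  then have r0R: "r0 \<in> R" by (simp add: R_def)
  have A0: "A \<nu> (kvec e \<nu>) k = 0" if "\<nu> \<notin> e" "k < 2 ^ s \<nu>" "k \<noteq> 0" for \<nu> k
    using assms(1)[of \<nu>] that by (simp add: kvec_def admissible_def)
  \<comment> \<open>At the centre \<open>c r0\<close> every other term vanishes, for one of two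
    reasons. A difference in a coordinate of \<open>e\<close> moves the ball away; a difference
    outside \<open>e\<close> does not move it, but there \<open>A \<nu> 0\<close> vanishes except at
    index 0.\<close>
  have off: "C r * wave (kfreq e j) (c r) j (c r0) = 0" if r: "r \<in> R" "r \<noteq> r0" for r
  proof -
    obtain \<nu> where \<nu>: "r \<nu> \<noteq> r0 \<nu>" using r by auto
    show ?thesis
    proof (cases "\<nu> \<in> e")
      case True
      have "c r0 \<notin> qball (c r) j"
      proof
        assume "c r0 \<in> qball (c r) j"
        then have "q2_abs (2 powi (- j) * b r0 $ \<nu> - 2 powi (- j) * b r $ \<nu>) \<le> 2 powi (j + 0)"
          by (simp add: mem_qball c_def)
        then have "q2_abs (b r0 $ \<nu> - b r $ \<nu>) \<le> 1"
          unfolding q2_abs_scale_le by (simp flip: mult.assoc power_int_add)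
        moreover have "b r0 $ \<nu> - b r $ \<nu> = (of_nat (r0 \<nu>) - of_nat (r \<nu>)) / 2 ^ s \<nu>"
          using True by (simp add: b_def kvec_def diff_divide_distrib)
        \<comment> \<open>Division by \<open>2 ^ s \<nu>\<close> enlarges the absolute value by that
          factor, so a common ball would make the two indices congruent modulo
          \<open>2 ^ s \<nu>\<close>.\<close>
        ultimately have "q2_abs (of_nat (r0 \<nu>) - of_nat (r \<nu>)) \<le> 2 powi (- int (s \<nu>))"
          by (simp add: q2_abs_divide q2_abs_power q2_abs_2 power_divide power_int_minus field_simps)
        then have "r0 \<nu> = r \<nu>"
          using r0(1) r(1) by (intro q2_integer_mod_power_unique[of _ "s \<nu>"]) (auto simp: R_def)
        then show False using \<nu> by simp
      qed
      then show ?thesis by (simp add: wave_def)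
    next
      case False
      then have "r0 \<nu> = 0" using A0[of \<nu> "r0 \<nu>"] r0 by auto
      then have "A \<nu> (kvec e \<nu>) (r \<nu>) = 0" using \<nu> r A0[OF False] by (auto simp: R_def)
      then have "(\<Prod>\<nu>\<in>UNIV. A \<nu> (kvec e \<nu>) (r \<nu>)) = 0" by (meson UNIV_I finite prod_zero)
      then show ?thesis by (simp add: C_def)
    qed
  qed
  have "(\<Sum>r\<in>R - {r0}. C r * wave (kfreq e j) (c r) j (c r0)) = 0"
    using off by (intro sum.neutral) auto
  then have "Psi s A e j a (c r0) = C r0 * wave (kfreq e j) (c r0) j (c r0)"
    unfolding Psi by (subst sum.remove[OF finR r0R]) simp
  moreover have "C r0 * wave (kfreq e j) (c r0) j (c r0) \<noteq> 0"
    using r0(2) by (simp add: C_def wave_def)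
  ultimately have nonzero: "Psi s A e j a \<noteq> (\<lambda>x. 0)" by force
  have "Psi s A e j a \<in> lizorkin"
    unfolding Psi by (rule sum_wave_lizorkin[OF finR gap])
  moreover have "taibleson \<alpha> (Psi s A e j a) = (\<lambda>x. 2 powr (\<alpha> * (1 - of_int j)) * Psi s A e j a x)"
    unfolding Psi taibleson_sum_wave[OF gap] vnorm_kfreq[OF assms(2)] of_real_2_powi_powr by simp
  ultimately show ?thesis using nonzero by (simp add: eigenfunction_on_def)
qed

end
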